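(* Let $k$ be a positive integer, let $G$ be a 2-connected graph, let $C$ be a cycle of $G$, and let $H$ be a (connected) component of $G-V(C)$. If there are at least $\frac{|H|+1}{2}$ vertices in $V(H)$ of degree at least $k$ in $G$, then there is an $(H,C)$-fan with at least $k$ edges.
   Context: All graphs are simple and finite. A 2-connected graph has at least 3 vertices, is connected, and has no cut-vertex. $|H|$ denotes the number of vertices of $H$. For a graph $G$, a cycle $C$ of $G$ and a component $H$ of $G-V(C)$, a subgraph $F$ of $G$ is called an $(H,C)$-fan if it is the union of paths $P_1,P_2,\ldots,P_t$, where $t\geq 2$, such that: (1) all $P_i$ have the same origin $v\in V(H)$ and pairwise different termini $u_i\in V(C)$, $1\leq i\leq t$; (2) all internal vertices of each $P_i$ are in $H$, and the $P_i$'s are pairwise internally disjoint (so two of them share only the origin $v$). *)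

theory Defs
  imports "Graph_Theory.Graph_Theory" "Graph_Theory.Kuratowski" Complex_Main
begin

text \<open>
  Finite simple graphs are the symmetric digraphs of the locale \<^locale>\<open>graph\<close>: finite, without
  loops and parallel arcs, with every undirected edge $uv$ represented by its two orientations.
  Hence the degree of a vertex is its out-degree, but edges must not be counted as arcs.
\<close>

definition edges :: "('a, 'b) pre_digraph \<Rightarrow> 'a set set" where
  "edges G = (\<lambda>a. {tail G a, head G a}) ` arcs G"

abbreviation degree :: "('a, 'b) pre_digraph \<Rightarrow> 'a \<Rightarrow> nat" where
  "degree G v \<equiv> out_degree G v"

definition components :: "('a, 'b) pre_digraph \<Rightarrow> ('a, 'b) pre_digraph set" where
  "components G = {H. pre_digraph.max_subgraph G connected H}"

definition cut_vertex :: "('a, 'b) pre_digraph \<Rightarrow> 'a \<Rightarrow> bool" where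
  "cut_vertex G v \<longleftrightarrow> v \<in> verts G \<and>
     card (components G) < card (components (pre_digraph.del_vert G v))"

definition two_connected :: "('a, 'b) pre_digraph \<Rightarrow> bool" where
  "two_connected G \<longleftrightarrow> 3 \<le> card (verts G) \<and> connected G \<and> \<not> (\<exists>v. cut_vertex G v)"

text \<open>
  A cycle of an undirected graph is given by a closed arc walk traversing it. The length
  requirement excludes the closed walks $u,v,u$ along the two orientations of a single edge, which
  \<^const>\<open>pre_digraph.cycle\<close> admits.
\<close>

definition graph_cycle :: "('a, 'b) pre_digraph \<Rightarrow> 'b awalk \<Rightarrow> bool" where
  "graph_cycle G C \<longleftrightarrow> pre_digraph.cycle G C \<and> 3 \<le> length C"

definition cycle_verts :: "('a, 'b) pre_digraph \<Rightarrow> 'b awalk \<Rightarrow> 'a set" where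
  "cycle_verts G C = tail G ` set C"

text \<open>
  The paths $P_1, \ldots, P_t$ form a set \<open>P\<close>; as their termini are pairwise different, nothing is
  lost by not indexing them. A set \<open>P\<close> with at least two elements by \<^const>\<open>card\<close> is finite.
  The last conjunct says that \<open>F\<close> is the union of the paths, which contributes both orientations of
  every edge of a path.
\<close>

definition is_fan ::
  "('a, 'b) pre_digraph \<Rightarrow> ('a, 'b) pre_digraph \<Rightarrow> 'b awalk \<Rightarrow> ('a, 'b) pre_digraph \<Rightarrow> bool" where
  "is_fan G H C F \<longleftrightarrow> subgraph F G \<and> (\<exists>v\<in>verts H. \<exists>P.
     2 \<le> card P \<and>
     (\<forall>p\<in>P. \<exists>u\<in>cycle_verts G C. pre_digraph.apath G v p u) \<and>
     inj_on (pre_digraph.awlast G v) P \<and>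
     (\<forall>p\<in>P. set (pre_digraph.inner_verts G p) \<subseteq> verts H) \<and>
     (\<forall>p\<in>P. \<forall>q\<in>P. p \<noteq> q \<longrightarrow>
        set (pre_digraph.awalk_verts G v p) \<inter> set (pre_digraph.awalk_verts G v q) = {v}) \<and>
     verts F = (\<Union>p\<in>P. set (pre_digraph.awalk_verts G v p)) \<and>
     arcs F = {a \<in> arcs G. \<exists>p\<in>P. \<exists>b\<in>set p. {tail G a, head G a} = {tail G b, head G b}})"

end

theory Submission
  imports Defs
begin

text \<open>
  Contracting the cycle to two terminals reduces the theorem to a strengthening of the
  Erdos--Gallai path theorem: if \<open>G + xy\<close> is 2-connected with \<open>n\<close> vertices, at least \<open>(n - 1) / 2\<close> of
  which are different from \<open>x\<close>, \<open>y\<close> and have degree at least \<open>k\<close>, then there is an \<open>x\<close>-\<open>y\<close> path with at least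
  \<open>k\<close> edges. More generally, if \<open>l\<close> inner vertices have degree at least \<open>k\<close>, there is a path with at least
  \<open>k - (n - 1 - 2 * l)\<close> edges, and one unit more is gained if \<open>x\<close> has a neighbour not counted in \<open>l\<close>.
  Both bounds are proved by simultaneous induction on \<open>n\<close>: two-vertex cuts are eliminated either by
  routing the path through one side or by replacing that side by an edge, and otherwise one moves from
  \<open>x\<close> to one of its neighbours or deletes a light vertex.
\<close>

section \<open>Paths and two-vertex cuts\<close>

text \<open>A side of a cut need not inherit that half of the vertices are heavy, so the induction
  carries the deficit \<open>n - 1 - 2 * l\<close> along. A side \<open>D\<close> contributes
  \<open>card D - 2 * card (L \<inter> D)\<close> to it: where this is small the path is routed
  through \<open>D\<close>, where it is large \<open>D\<close> is worth replacing by an edge. The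
  price is that a cut vertex in \<open>L\<close> may lose its degree, at two units each. The
  critical situation is \<open>n = 2 * l + 1\<close> with only heavy neighbours at \<open>x\<close>.
  Moving to one of them removes one vertex but two units of \<open>2 * l\<close>, so the resulting
  path is one edge short. The bound for light neighbours exists to regain this edge. One path is
  enough for a fan because all legs but one can be single edges: the first inner vertex of the path
  becomes the origin, the path becomes the long leg, and further neighbours of the origin on the
  cycle end the short legs.\<close>

definition nbh :: "'a set \<Rightarrow> ('a \<Rightarrow> 'a \<Rightarrow> bool) \<Rightarrow> 'a set \<Rightarrow> 'a set" where
  "nbh V E D = {w \<in> V - D. \<exists>d\<in>D. E d w}"

definition deg :: "'a set \<Rightarrow> ('a \<Rightarrow> 'a \<Rightarrow> bool) \<Rightarrow> 'a \<Rightarrow> nat" where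
  "deg V E v = card {w \<in> V. E v w}"

definition add_edge :: "('a \<Rightarrow> 'a \<Rightarrow> bool) \<Rightarrow> 'a \<Rightarrow> 'a \<Rightarrow> 'a \<Rightarrow> 'a \<Rightarrow> bool" where
  "add_edge E a b u v \<longleftrightarrow> E u v \<or> u = a \<and> v = b \<or> u = b \<and> v = a"

definition upath :: "'a set \<Rightarrow> ('a \<Rightarrow> 'a \<Rightarrow> bool) \<Rightarrow> 'a \<Rightarrow> 'a list \<Rightarrow> 'a \<Rightarrow> bool" where
  "upath V E x p y \<longleftrightarrow> p \<noteq> [] \<and> hd p = x \<and> last p = y \<and> distinct p \<and> set p \<subseteq> V \<and> successively E p"

text \<open>
  Adding the edge \<open>xy\<close> makes the graph 2-connected. Phrasing this through neighbourhoods of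
  arbitrary vertex sets, not necessarily connected, lets all cut arguments avoid components.
\<close>

definition biconn :: "'a set \<Rightarrow> ('a \<Rightarrow> 'a \<Rightarrow> bool) \<Rightarrow> 'a \<Rightarrow> 'a \<Rightarrow> bool" where
  "biconn V E x y \<longleftrightarrow> finite V \<and> symp E \<and> irreflp E \<and> x \<in> V \<and> y \<in> V \<and> x \<noteq> y \<and> V - {x, y} \<noteq> {} \<and>
     (\<forall>D c. D \<noteq> {} \<longrightarrow> D \<subseteq> V - {x, y} \<longrightarrow> \<not> nbh V E D \<subseteq> {c})"

definition heavy :: "'a set \<Rightarrow> ('a \<Rightarrow> 'a \<Rightarrow> bool) \<Rightarrow> 'a \<Rightarrow> 'a \<Rightarrow> nat \<Rightarrow> 'a set \<Rightarrow> bool" where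
  "heavy V E x y k L \<longleftrightarrow> L \<subseteq> V - {x, y} \<and> (\<forall>v\<in>L. k \<le> deg V E v)"

text \<open>
  A path with at least \<open>m\<close> edges; the list of its vertices is longer by one.
\<close>

definition haspath :: "'a set \<Rightarrow> ('a \<Rightarrow> 'a \<Rightarrow> bool) \<Rightarrow> 'a \<Rightarrow> 'a \<Rightarrow> nat \<Rightarrow> bool" where
  "haspath V E x y m \<longleftrightarrow> (\<exists>p. upath V E x p y \<and> m < length p)"

lemma haspath_mono: "haspath V E x y m \<Longrightarrow> m' \<le> m \<Longrightarrow> haspath V E x y m'"
  unfolding haspath_def by force

lemma biconnD:
  assumes "biconn V E x y"
  shows "finite V" "symp E" "irreflp E" "x \<in> V" "y \<in> V" "x \<noteq> y" "V - {x, y} \<noteq> {}"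
    and "D \<noteq> {} \<Longrightarrow> D \<subseteq> V - {x, y} \<Longrightarrow> \<not> nbh V E D \<subseteq> {c}"
  using assms unfolding biconn_def by blast+

lemma biconnI:
  assumes "finite V" "symp E" "irreflp E" "x \<in> V" "y \<in> V" "x \<noteq> y" "V - {x, y} \<noteq> {}"
    and "\<And>D c. D \<noteq> {} \<Longrightarrow> D \<subseteq> V - {x, y} \<Longrightarrow> nbh V E D \<subseteq> {c} \<Longrightarrow> False"
  shows "biconn V E x y"
  using assms unfolding biconn_def by blast

lemma biconn_commute: "biconn V E x y \<longleftrightarrow> biconn V E y x"
  unfolding biconn_def by (auto simp: insert_commute)

lemma heavy_commute: "heavy V E x y k L \<longleftrightarrow> heavy V E y x k L"
  unfolding heavy_def by (auto simp: insert_commute)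

lemma biconn_card:
  assumes "biconn V E x y"
  shows "3 \<le> card V"
proof -
  obtain v where "v \<in> V - {x, y}" using biconnD(7)[OF assms] by blast
  then have "{x, y, v} \<subseteq> V" "card {x, y, v} = 3" using biconnD[OF assms] by auto
  then show ?thesis using card_mono[OF biconnD(1)[OF assms]] by metis
qed

section \<open>Assembling paths, and reachability\<close>

lemma upath_rev:
  assumes "upath V E x p y" "symp E"
  shows "upath V E y (rev p) x"
proof -
  have "(\<lambda>a b. E b a) = E" using assms(2) by (auto simp: fun_eq_iff symp_def)
  then have "successively E (rev p) = successively E p" by (simp only: successively_rev)
  then show ?thesis using assms(1) unfolding upath_def by (simp add: hd_rev last_rev)
qed

lemma haspath_commute:
  assumes "symp E" "haspath V E x y m"
  shows "haspath V E y x m"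
  using assms upath_rev unfolding haspath_def by (metis length_rev)

lemma upath_mono:
  assumes "upath V E x p y" "V \<subseteq> V'" "\<And>u v. u \<in> V \<Longrightarrow> v \<in> V \<Longrightarrow> E u v \<Longrightarrow> E' u v"
  shows "upath V' E' x p y"
proof -
  have "successively E' p"
    by (rule successively_mono[of E]) (use assms in \<open>auto simp: upath_def\<close>)
  then show ?thesis using assms unfolding upath_def by blast
qed

lemma haspath_subset:
  assumes "haspath V E x y m" "V \<subseteq> V'"
  shows "haspath V' E x y m"
  using assms upath_mono[where E' = E] unfolding haspath_def by metis

lemma upath_Cons:
  assumes "upath W E x' p y" "W \<subseteq> V" "x \<in> V" "x \<notin> W" "E x x'"
  shows "upath V E x (x # p) y"
  using assms unfolding upath_def by (cases p) auto

lemma haspath_Cons: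
  assumes "haspath (V - {x}) E x' y m" "x \<in> V" "E x x'"
  shows "haspath V E x y (Suc m)"
proof -
  obtain p where p: "upath (V - {x}) E x' p y" "m < length p" using assms(1) unfolding haspath_def by blast
  show ?thesis unfolding haspath_def
    by (intro exI[of _ "x # p"] conjI upath_Cons[OF p(1)]) (use assms p(2) in auto)
qed

lemma upath_append:
  assumes "upath V E x p a" "upath V E b q y" "set p \<inter> set q = {}" "E a b"
  shows "upath V E x (p @ q) y"
  using assms unfolding upath_def by (auto simp: successively_append_iff)

lemma upath_glue:
  assumes "upath V E x p c" "upath V E c q y" "set p \<inter> set q \<subseteq> {c}"
  shows "upath V E x (p @ tl q) y"
proof (cases "tl q")
  case Nil
  then show ?thesis using assms unfolding upath_def by (cases q) auto
next
  case (Cons b q')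
  then obtain q0: "q = c # b # q'" using assms(2) unfolding upath_def by (cases q) auto
  have "upath V E b (b # q') y" using assms(2) q0 unfolding upath_def by auto
  moreover have "set p \<inter> set (b # q') = {}" "E c b"
    using assms q0 unfolding upath_def by auto
  ultimately show ?thesis using upath_append[OF assms(1)] Cons by auto
qed

lemma upath_step:
  assumes "upath W E c p v" "w \<in> W" "E v w"
  shows "\<exists>q. upath W E c q w"
proof (cases "w \<in> set p")
  case True
  then obtain p1 p2 where p: "p = p1 @ w # p2" by (auto dest: split_list)
  have "upath W E c (p1 @ [w]) w"
    using assms(1) unfolding p upath_def by (auto simp: successively_append_iff hd_append)
  then show ?thesis by blast
next
  case False
  have "upath W E w [w] w" using assms(2) by (simp add: upath_def)
  then show ?thesis using upath_append[OF assms(1), of w "[w]" w] assms(3) False by auto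
qed

text \<open>Simple paths instead of a closure: a reachable vertex comes with a path that can be
  glued to others.\<close>

definition reach :: "'a set \<Rightarrow> ('a \<Rightarrow> 'a \<Rightarrow> bool) \<Rightarrow> 'a \<Rightarrow> 'a set" where
  "reach W E c = {v. \<exists>p. upath W E c p v}"

lemma reach_self: "c \<in> W \<Longrightarrow> c \<in> reach W E c"
  unfolding reach_def upath_def by (auto intro!: exI[of _ "[c]"])

lemma reach_subset: "reach W E c \<subseteq> W"
  unfolding reach_def upath_def by auto

lemma reach_step: "v \<in> reach W E c \<Longrightarrow> w \<in> W \<Longrightarrow> E v w \<Longrightarrow> w \<in> reach W E c"
  unfolding reach_def using upath_step by fastforce

section \<open>The two sides of a two-vertex cut\<close>

lemma nbh_mono_subset: "nbh V E D \<subseteq> V - D"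
  unfolding nbh_def by auto

text \<open>Vertices of \<open>D\<close> keep all their neighbours when the graph is restricted to
  \<open>D\<close> and its attachments, so a bad subset of \<open>D\<close> there would be bad in
  the whole graph.\<close>

lemma cut_inner:
  assumes G: "biconn V E x y" and D: "D \<noteq> {}" "D \<subseteq> V - {x, y}" "a \<notin> D" "b \<notin> D" "a \<in> V" "b \<in> V" "a \<noteq> b"
    and N: "nbh V E D \<subseteq> {a, b}"
  shows "biconn (D \<union> {a, b}) E a b"
proof (rule biconnI)
  fix D' c assume D': "D' \<noteq> {}" "D' \<subseteq> D \<union> {a, b} - {a, b}" "nbh (D \<union> {a, b}) E D' \<subseteq> {c}"
  have "nbh V E D' \<subseteq> nbh (D \<union> {a, b}) E D'"
  proof
    fix w assume "w \<in> nbh V E D'"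
    then obtain d where d: "w \<in> V" "w \<notin> D'" "d \<in> D'" "E d w" unfolding nbh_def by auto
    then have "d \<in> D" using D'(2) by auto
    then have "w \<in> D \<union> {a, b}" using N d unfolding nbh_def by auto
    then show "w \<in> nbh (D \<union> {a, b}) E D'" using d unfolding nbh_def by auto
  qed
  then have "nbh V E D' \<subseteq> {c}" using D'(3) by (rule subset_trans)
  moreover have "D' \<subseteq> V - {x, y}" using D'(2) D(2) by auto
  ultimately show False using biconnD(8)[OF G D'(1)] by blast
qed (use biconnD[OF G] D finite_subset[of D V] in auto)

lemma heavy_inner:
  assumes H: "heavy V E x y k L" and D: "D \<subseteq> V - {x, y}" "a \<notin> D" "b \<notin> D" "a \<in> V" "b \<in> V" "irreflp E"
    and N: "nbh V E D \<subseteq> {a, b}"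
  shows "heavy (D \<union> {a, b}) E a b k (L \<inter> D)"
proof -
  have "{w \<in> V. E v w} = {w \<in> D \<union> {a, b}. E v w}" if "v \<in> D" for v
    using that N D(1,4,5) unfolding nbh_def by auto
  then show ?thesis using H D unfolding heavy_def deg_def by auto
qed

lemma symp_add_edge: "symp E \<Longrightarrow> symp (add_edge E a b)"
  unfolding symp_def add_edge_def by blast

lemma irreflp_add_edge: "irreflp E \<Longrightarrow> a \<noteq> b \<Longrightarrow> irreflp (add_edge E a b)"
  unfolding irreflp_def add_edge_def by blast

text \<open>If \<open>D'\<close> contains an end of the new edge, that edge stands for the side
  \<open>D\<close>, and \<open>D \<union> D'\<close> is tested in the old graph; otherwise
  \<open>D'\<close> itself is.\<close>

lemma cut_outer:
  assumes G: "biconn V E x y" and D: "D \<noteq> {}" "D \<subseteq> V - {x, y}" "a \<notin> D" "b \<notin> D" "a \<in> V" "b \<in> V" "a \<noteq> b"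
    and N: "nbh V E D \<subseteq> {a, b}" and ne: "V - D - {x, y} \<noteq> {}"
  shows "biconn (V - D) (add_edge E a b) x y"
proof (rule biconnI)
  fix D' c assume D': "D' \<noteq> {}" "D' \<subseteq> V - D - {x, y}" "nbh (V - D) (add_edge E a b) D' \<subseteq> {c}"
  have 0: "\<not> E d w \<and> \<not> E w d" if "d \<in> D" "w \<in> V" "w \<notin> D" "w \<notin> {a, b}" for d w
    using that N sympD[OF biconnD(2)[OF G]] unfolding nbh_def by auto
  show False
  proof (cases "a \<in> D' \<or> b \<in> D'")
    case True
    have "w = c" if w: "w \<in> V" "w \<notin> D" "w \<notin> D'" "d \<in> D \<union> D'" "E d w" for w d
    proof (cases "w \<in> {a, b}")
      case True
      then have "w \<in> nbh (V - D) (add_edge E a b) D'"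
        using \<open>a \<in> D' \<or> b \<in> D'\<close> w unfolding nbh_def add_edge_def by auto
      then show ?thesis using D'(3) by auto
    next
      case False
      then have "d \<in> D'" using 0[of d w] w by auto
      then have "w \<in> nbh (V - D) (add_edge E a b) D'" using w unfolding nbh_def add_edge_def by auto
      then show ?thesis using D'(3) by auto
    qed
    then have "nbh V E (D \<union> D') \<subseteq> {c}" unfolding nbh_def by auto
    moreover have "D \<union> D' \<noteq> {}" "D \<union> D' \<subseteq> V - {x, y}" using D' D by auto
    ultimately show False using biconnD(8)[OF G, of "D \<union> D'"] by blast
  next
    case False
    have "w = c" if w: "w \<in> V" "w \<notin> D'" "d \<in> D'" "E d w" for w d
    proof -
      have "w \<notin> D" using 0[of w d] w False D'(2) by auto
      then have "w \<in> nbh (V - D) (add_edge E a b) D'" using w unfolding nbh_def add_edge_def by auto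
      then show ?thesis using D'(3) by auto
    qed
    then have "nbh V E D' \<subseteq> {c}" unfolding nbh_def by auto
    moreover have "D' \<subseteq> V - {x, y}" using D' by auto
    ultimately show False using biconnD(8)[OF G D'(1)] by blast
  qed
qed (use biconnD[OF G] D ne symp_add_edge[of E a b] irreflp_add_edge[of E a b] in auto)

lemma deg_mono:
  assumes "finite V'" "{w \<in> V. E v w} \<subseteq> {w \<in> V'. E' v w}"
  shows "deg V E v \<le> deg V' E' v"
  using assms unfolding deg_def by (auto intro: card_mono)

text \<open>Outside \<open>D\<close> only \<open>a\<close> and \<open>b\<close> can lose neighbours,
  hence they alone are struck from the remaining heavy vertices.\<close>

lemma heavy_outer:
  assumes H: "heavy V E x y k L" and G: "biconn V E x y" and N: "nbh V E D \<subseteq> {a, b}"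
  shows "heavy (V - D) (add_edge E a b) x y k (L - D - {a, b})"
proof -
  have "k \<le> deg (V - D) (add_edge E a b) v" if v: "v \<in> L - D - {a, b}" for v
  proof -
    have "{w \<in> V. E v w} \<subseteq> {w \<in> V - D. add_edge E a b v w}"
    proof
      fix w assume w: "w \<in> {w \<in> V. E v w}"
      have "w \<notin> D"
      proof
        assume "w \<in> D"
        then have "v \<in> nbh V E D"
          using w v H sympD[OF biconnD(2)[OF G]] unfolding nbh_def heavy_def by auto
        then show False using N v by auto
      qed
      then show "w \<in> {w \<in> V - D. add_edge E a b v w}" using w unfolding add_edge_def by auto
    qed
    then show ?thesis using deg_mono H v biconnD(1)[OF G]
      unfolding heavy_def by (metis Diff_iff finite_Diff le_trans)
  qed
  then show ?thesis using H unfolding heavy_def by blast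
qed

text \<open>The ends of \<open>r\<close> already occur as the last vertex of \<open>p\<close> and
  the first of \<open>q\<close>; \<open>butlast (tl r)\<close> avoids repeating them, whence the
  \<open>+ 2\<close>.\<close>

lemma upath_splice:
  assumes p: "upath W E x p a" and q: "upath W E b q y" and pq: "set p \<inter> set q = {}"
    and r: "upath (D \<union> {a, b}) E a r b" and WD: "W \<inter> D = {}"
  shows "upath (W \<union> D) E x (p @ butlast (tl r) @ q) y"
    and "length (p @ butlast (tl r) @ q) + 2 = length p + length q + length r"
proof -
  have ab: "a \<noteq> b" using p q pq unfolding upath_def by (metis disjoint_iff last_in_set list.set_sel(1))
  obtain r' where r': "r = a # r' @ [b]"
  proof -
    from r ab obtain s where s: "r = a # s" "s \<noteq> []" unfolding upath_def by (cases r) (auto split: if_splits)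
    then have "r = a # butlast s @ [b]" using r unfolding upath_def by auto
    then show ?thesis using that by blast
  qed
  have r0: "set r' \<subseteq> D" "distinct r'" "successively E r" using r r' unfolding upath_def by auto
  have b0: "butlast (tl r) = r'" using r' by simp
  show "length (p @ butlast (tl r) @ q) + 2 = length p + length q + length r" using r' by simp
  have "upath (W \<union> D) E x (p @ r' @ q) y"
  proof (cases "r' = []")
    case True
    then have "E a b" using r0 r' by simp
    then show ?thesis using True upath_append[OF p q pq] upath_mono[of W E x "p @ q" y "W \<union> D" E] by auto
  next
    case False
    have e: "E a (hd r')" "E (last r') b" "successively E r'"
      using r0(3) False unfolding r' by (auto simp: successively_append_iff successively_Cons)
    have "set p \<inter> set r' = {}" "set r' \<inter> set q = {}" using r0 p q WD unfolding upath_def by blast+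
    then show ?thesis using p q pq e r0 False
      unfolding upath_def by (auto simp: successively_append_iff)
  qed
  then show "upath (W \<union> D) E x (p @ butlast (tl r) @ q) y" using b0 by simp
qed

text \<open>A simple path uses the new edge at most once, because the end at which it enters this
  edge does not recur.\<close>

lemma successively_add_edge:
  assumes "successively (add_edge E a b) p" "distinct p"
  shows "successively E p \<or> (\<exists>p1 p2 c d. p = p1 @ c # d # p2 \<and> {c, d} = {a, b} \<and>
           successively E (p1 @ [c]) \<and> successively E (d # p2))"
  using assms
proof (induction p)
  case Nil then show ?case by simp
next
  case (Cons u p)
  show ?case
  proof (cases p)
    case Nil then show ?thesis by simp
  next
    case (Cons v p')
    have uv: "add_edge E a b u v" and s: "successively (add_edge E a b) p"
      using Cons.prems Cons by auto
    show ?thesis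
    proof (cases "E u v")
      case True
      from Cons.IH[OF s] Cons.prems(2) consider "successively E p"
        | p1 p2 c d where "p = p1 @ c # d # p2" "{c, d} = {a, b}"
           "successively E (p1 @ [c])" "successively E (d # p2)" by auto
      then show ?thesis
      proof cases
        case 1 then show ?thesis using True Cons by simp
      next
        case 2
        have "successively E ((u # p1) @ [c])" using 2 True Cons by (cases p1) auto
        then show ?thesis using 2 by (intro disjI2 exI[of _ "u # p1"] exI[of _ p2]) auto
      qed
    next
      case False
      then have uv': "{u, v} = {a, b}" using uv unfolding add_edge_def by auto
      have "successively E p"
      proof (rule successively_mono[OF s])
        fix c d assume cd: "c \<in> set p" "d \<in> set p" "add_edge E a b c d"
        have "u \<notin> set p" using Cons.prems by simp
        then show "E c d" using cd uv' unfolding add_edge_def by (auto simp: doubleton_eq_iff)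
      qed
      then show ?thesis using uv' Cons by (intro disjI2 exI[of _ "[]"] exI[of _ p']) auto
    qed
  qed
qed

text \<open>The detour through \<open>D\<close> has at least one edge, so putting it in place of the
  new edge, in whichever direction that is traversed, never shortens the path.\<close>

lemma lift_path:
  assumes p: "upath W (add_edge E a b) x p y" and r: "upath (D \<union> {a, b}) E a r b" "a \<noteq> b"
    and E: "symp E" and WD: "W \<inter> D = {}"
  shows "\<exists>q. upath (W \<union> D) E x q y \<and> length p \<le> length q \<and> set p \<subseteq> set q"
proof -
  have r2: "2 \<le> length r" using r unfolding upath_def by (cases r; cases "tl r") auto
  from p have "successively (add_edge E a b) p" "distinct p" unfolding upath_def by auto
  from successively_add_edge[OF this] consider "successively E p"
    | p1 p2 c d where "p = p1 @ c # d # p2" "{c, d} = {a, b}"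
      "successively E (p1 @ [c])" "successively E (d # p2)" by blast
  then show ?thesis
  proof cases
    case 1
    then have "upath (W \<union> D) E x p y" using p unfolding upath_def by auto
    then show ?thesis by blast
  next
    case 2
    obtain r' where r': "upath (D \<union> {c, d}) E c r' d" "length r' = length r"
    proof (cases "c = a")
      case True
      then have "d = b" using 2(2) r(2) by (auto simp: doubleton_eq_iff)
      then show ?thesis using that[of r] r(1) True by simp
    next
      case False
      then have "c = b" "d = a" using 2(2) by (auto simp: doubleton_eq_iff)
      then show ?thesis using that[of "rev r"] upath_rev[OF r(1) E] by (simp add: insert_commute)
    qed
    have pd: "distinct p" "set p \<subseteq> W" "hd p = x" "last p = y" using p unfolding upath_def by auto
    have "hd (p1 @ [c]) = x" using pd(3) 2(1) by (cases p1) auto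
    then have P: "upath W E x (p1 @ [c]) c" "upath W E d (d # p2) y"
      "set (p1 @ [c]) \<inter> set (d # p2) = {}"
      using pd(1,2,4) 2(1,3,4) unfolding upath_def by simp_all
    let ?q = "(p1 @ [c]) @ butlast (tl r') @ d # p2"
    have "length p \<le> length ?q"
      using upath_splice(2)[OF P r'(1) WD] r2 r'(2) 2(1) by simp
    moreover have "set p \<subseteq> set ?q" unfolding 2(1) by auto
    ultimately show ?thesis using upath_splice(1)[OF P r'(1) WD] by blast
  qed
qed

section \<open>Obstructing cuts and paths through a prescribed vertex\<close>

lemma nbh_subset_iff: "nbh V E D \<subseteq> S \<longleftrightarrow> (\<forall>u\<in>D. \<forall>w\<in>V. E u w \<longrightarrow> w \<in> D \<union> S)"
  unfolding nbh_def by auto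

lemma biconn_no_cut:
  assumes "biconn V E x y" "D \<noteq> {}" "D \<subseteq> V - {x, y}"
    and "\<And>u w. u \<in> D \<Longrightarrow> w \<in> V \<Longrightarrow> E u w \<Longrightarrow> w \<notin> D \<Longrightarrow> w = c"
  shows False
proof -
  have "nbh V E D \<subseteq> {c}" unfolding nbh_subset_iff using assms(4) by auto
  then show False using biconnD(8)[OF assms(1-3), of c] by blast
qed

lemma cut_pair:
  assumes G: "biconn V E x y" and D: "D \<noteq> {}" "D \<subseteq> V - {x, y}" and N: "nbh V E D \<subseteq> {a, b}"
  shows "nbh V E D = {a, b}" "a \<noteq> b" "a \<in> V" "b \<in> V" "a \<notin> D" "b \<notin> D"
proof -
  have "\<not> nbh V E D \<subseteq> {a}" "\<not> nbh V E D \<subseteq> {b}" by (rule biconnD(8)[OF G D])+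
  then show e: "nbh V E D = {a, b}" and "a \<noteq> b" using N by auto
  then show "a \<in> V" "b \<in> V" "a \<notin> D" "b \<notin> D" using nbh_mono_subset[of V E D] by auto
qed

lemma biconn_neighbour:
  assumes G: "biconn V E x y"
  obtains x' where "x' \<in> V - {x, y}" "E x x'"
proof -
  have "\<not> nbh V E (V - {x, y}) \<subseteq> {y}" using biconnD(7)[OF G] biconnD(8)[OF G, of "V - {x, y}" y] by auto
  then obtain u where "u \<in> V - {x, y}" "E u x" unfolding nbh_def by auto
  then show ?thesis using that sympD[OF biconnD(2)[OF G]] by blast
qed

text \<open>Otherwise the vertices reachable from \<open>c\<close>, together with \<open>D\<close>,
  would have \<open>x\<close> as their only outside neighbour.\<close>

lemma path_beyond_cut:
  assumes G: "biconn V E x y" and D: "D \<subseteq> V - {x, y}" and c: "c \<in> V" "c \<noteq> x" "c \<notin> D"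
    and N: "nbh V E D \<subseteq> {x, c}"
  shows "\<exists>q. upath (V - D - {x}) E c q y"
proof (rule ccontr)
  define A where "A = reach (V - D - {x}) E c"
  assume "\<not> ?thesis"
  then have y: "y \<notin> A" unfolding A_def reach_def by auto
  have A: "c \<in> A" "A \<subseteq> V - D - {x}"
    unfolding A_def using reach_self[of c "V - D - {x}" E] reach_subset[of "V - D - {x}" E c] c by auto
  have st: "w \<in> A" if "u \<in> A" "w \<in> V - D - {x}" "E u w" for u w
    using that unfolding A_def by (rule reach_step)
  show False
  proof (rule biconn_no_cut[OF G, of "A \<union> D" x])
    fix u w assume w: "u \<in> A \<union> D" "w \<in> V" "E u w" "w \<notin> A \<union> D"
    show "w = x"
    proof (cases "u \<in> A")
      case True then show ?thesis using st[of u w] w by auto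
    next
      case False
      then show ?thesis using N w A unfolding nbh_subset_iff by auto
    qed
  qed (use A D y in auto)
qed

text \<open>A set that is bad after the deletion of \<open>x\<close> regains at most the neighbour
  \<open>x\<close> when \<open>x\<close> is put back, so it is a side of a cut
  \<open>{x, c}\<close>.\<close>

lemma step_or_cut:
  assumes G: "biconn V E x y" and x': "x' \<in> V - {x, y}" and ne: "V - {x, x', y} \<noteq> {}"
  shows "biconn (V - {x}) E x' y \<or>
    (\<exists>D c. D \<noteq> {} \<and> D \<subseteq> V - {x, x', y} \<and> nbh V E D \<subseteq> {x, c} \<and> nbh (V - {x}) E D \<subseteq> {c})"
proof (rule ccontr)
  assume neg: "\<not> ?thesis"
  have "biconn (V - {x}) E x' y"
  proof (rule biconnI)
    fix D c assume D: "D \<noteq> {}" "D \<subseteq> V - {x} - {x', y}" "nbh (V - {x}) E D \<subseteq> {c}"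
    then have "nbh V E D \<subseteq> {x, c}" unfolding nbh_def by auto
    then show False using neg D by blast
  qed (use biconnD[OF G] x' ne in auto)
  then show False using neg by blast
qed

lemma delete_or_cut:
  assumes G: "biconn V E x y" and ne: "V - {x, y, z} \<noteq> {}" and z: "z \<in> V - {x, y}"
  shows "biconn (V - {z}) E x y \<or>
    (\<exists>D c. D \<noteq> {} \<and> D \<subseteq> V - {x, y} \<and> z \<notin> D \<and> nbh V E D \<subseteq> {z, c})"
proof (rule ccontr)
  assume neg: "\<not> ?thesis"
  have "biconn (V - {z}) E x y"
  proof (rule biconnI)
    fix D c assume D: "D \<noteq> {}" "D \<subseteq> V - {z} - {x, y}" "nbh (V - {z}) E D \<subseteq> {c}"
    then have "nbh V E D \<subseteq> {z, c}" unfolding nbh_def by auto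
    then show False using neg D by blast
  qed (use biconnD[OF G] ne z in auto)
  then show False using neg by blast
qed

lemma card_cut_inner:
  assumes "biconn V E x y" "D \<subseteq> V - {x, y}" "a \<in> V" "b \<in> V" "{a, b} \<noteq> {x, y}" "a \<noteq> b"
  shows "card (D \<union> {a, b}) < card V"
proof (rule psubset_card_mono)
  show "finite V" using biconnD[OF assms(1)] by blast
  have "x \<in> V" "y \<in> V" "x \<noteq> y" using biconnD[OF assms(1)] by blast+
  then show "D \<union> {a, b} \<subset> V" using assms by auto
qed

lemma card_cut_outer:
  assumes "biconn V E x y" "D \<subseteq> V - {x, y}" "D \<noteq> {}"
  shows "card (V - D) < card V"
  using biconnD(1)[OF assms(1)] assms by (intro psubset_card_mono) auto

text \<open>This takes the place of Menger's theorem and rests on the same alternative between a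
  step and a cut as the bounds. At a cut \<open>{x, c}\<close> the path is routed through
  \<open>D\<close> if \<open>v\<close> lies there, and otherwise found in the graph with
  \<open>D\<close> replaced by an edge.\<close>

lemma path_through:
  assumes "biconn V E x y" "v \<in> V - {x, y}"
  shows "\<exists>p. upath V E x p y \<and> v \<in> set p"
  using assms
proof (induction "card V" arbitrary: V E x y v rule: less_induct)
  case less
  note G = less.prems(1) and v = less.prems(2)
  note GD = biconnD[OF G]
  obtain x' where x': "x' \<in> V - {x, y}" "E x x'" by (rule biconn_neighbour[OF G])
  have card_x: "card (V - {x}) < card V" using GD(1,4) by (intro psubset_card_mono) auto
  show ?case
  proof (cases "V - {x, x', y} = {}")
    case True
    then have V: "V = {x, x', y}" and vx: "v = x'" using GD x' v by auto
    have "\<not> nbh V E {x'} \<subseteq> {x}" using GD(8)[of "{x'}" x] x' by auto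
    then have "E x' y" using GD(3) unfolding V nbh_def irreflp_def by auto
    then have "upath V E x [x, x', y] y" using x' GD unfolding upath_def by auto
    then show ?thesis using vx by (intro exI[of _ "[x, x', y]"]) auto
  next
    case ne: False
    from step_or_cut[OF G x'(1) ne] show ?thesis
    proof (elim disjE exE conjE)
      assume G': "biconn (V - {x}) E x' y"
      \<comment> \<open>The induction hypothesis speaks of inner vertices. If \<open>v\<close> is
        the new start \<open>x'\<close>, the path begins at \<open>v\<close> anyway, and any inner
        vertex serves as \<open>w\<close>.\<close>
      obtain w where w: "w \<in> V - {x} - {x', y}" "v \<noteq> x' \<Longrightarrow> w = v" using ne v by blast
      from less.hyps[OF card_x G' w(1)] obtain p where p: "upath (V - {x}) E x' p y" "w \<in> set p" by blast
      have "x' \<in> set p" using p(1) unfolding upath_def by (metis hd_in_set)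
      then have "v \<in> set p" using p w by metis
      moreover have "upath V E x (x # p) y" by (rule upath_Cons[OF p(1)]) (use GD x' in auto)
      ultimately show ?thesis by (intro exI[of _ "x # p"]) auto
    next
      fix D c assume D0: "D \<noteq> {}" "D \<subseteq> V - {x, x', y}" and N: "nbh V E D \<subseteq> {x, c}"
      then have D: "D \<subseteq> V - {x, y}" "x' \<notin> D" by auto
      note cp = cut_pair[OF G D0(1) D(1) N]
      have GI: "biconn (D \<union> {x, c}) E x c" by (rule cut_inner[OF G D0(1) D(1)]) (use cp N in auto)
      have "card (D \<union> {x, c}) < card V"
      proof (rule psubset_card_mono[OF GD(1)])
        have "x' \<noteq> y" "x' \<notin> D \<union> {x} \<and> y \<notin> D \<union> {x}" using x' D GD by auto
        then show "D \<union> {x, c} \<subset> V" using D cp GD x' by blast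
      qed
      note IH1 = less.hyps[OF this GI]
      show ?thesis
      proof (cases "v \<in> D")
        case True
        then obtain p where p: "upath (D \<union> {x, c}) E x p c" "v \<in> set p" using IH1[of v] cp by auto
        obtain q where q: "upath (V - D - {x}) E c q y" using path_beyond_cut[OF G D(1)] cp N by blast
        have "upath V E x (p @ tl q) y"
        proof (rule upath_glue)
          show "upath V E x p c" by (rule upath_mono[OF p(1)]) (use D cp GD in auto)
          show "upath V E c q y" by (rule upath_mono[OF q]) auto
          show "set p \<inter> set q \<subseteq> {c}" using p(1) q unfolding upath_def by auto
        qed
        then show ?thesis using p(2) by (intro exI[of _ "p @ tl q"]) auto
      next
        case False
        obtain d where "d \<in> D" using D0 by blast
        then obtain r where r: "upath (D \<union> {x, c}) E x r c" using IH1[of d] cp by auto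
        have GO: "biconn (V - D) (add_edge E x c) x y"
          by (rule cut_outer[OF G D0(1) D(1)]) (use cp N x' D in auto)
        from less.hyps[OF card_cut_outer[OF G D(1) D0(1)] GO, of v] obtain p
          where p: "upath (V - D) (add_edge E x c) x p y" "v \<in> set p" using False v by blast
        have "V - D \<union> D = V" using D by auto
        then show ?thesis using lift_path[OF p(1) r cp(2) GD(2)] p(2) by auto
      qed
    qed
  qed
qed

lemma haspath_2:
  assumes G: "biconn V E x y"
  shows "haspath V E x y 2"
proof -
  obtain v where v: "v \<in> V - {x, y}" using biconnD(7)[OF G] by blast
  obtain p where p: "upath V E x p y" "v \<in> set p" using path_through[OF G v] by blast
  have "{x, y, v} \<subseteq> set p" using p unfolding upath_def by (metis empty_subsetI hd_in_set insert_subset last_in_set)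
  moreover have "card {x, y, v} = 3" using v biconnD(6)[OF G] by auto
  ultimately have "3 \<le> card (set p)" by (metis card_mono List.finite_set)
  also have "\<dots> \<le> length p" by (rule card_length)
  finally show ?thesis using p unfolding haspath_def by auto
qed

text \<open>A path through \<open>D\<close> is cut before its first and after its last vertex in
  \<open>D\<close>. Both cut ends border \<open>D\<close>, hence lie in \<open>{a, b}\<close>, and
  they differ because the two pieces are disjoint. Their order is unknown, which is why they are
  called \<open>c\<close> and \<open>d\<close>.\<close>

lemma linking_paths:
  assumes G: "biconn V E x y" and D: "D \<noteq> {}" "D \<subseteq> V - {x, y}" and N: "nbh V E D \<subseteq> {a, b}"
  obtains c d p q where "{c, d} = {a, b}" "upath (V - D) E x p c" "upath (V - D) E d q y" "set p \<inter> set q = {}"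
proof -
  note GD = biconnD[OF G]
  obtain v where v: "v \<in> D" using D by blast
  obtain P where P: "upath V E x P y" "v \<in> set P" using path_through[OF G, of v] v D by blast
  obtain p d1 s where 1: "P = p @ d1 # s" "d1 \<in> D" "\<forall>u\<in>set p. u \<notin> D"
    using split_list_first_prop[of P "\<lambda>u. u \<in> D"] P v by blast
  obtain s' d2 q where 2: "P = s' @ d2 # q" "d2 \<in> D" "\<forall>u\<in>set q. u \<notin> D"
    using split_list_last_prop[of P "\<lambda>u. u \<in> D"] P v by blast
  have P0: "hd P = x" "last P = y" "distinct P" "set P \<subseteq> V" "successively E P"
    using P(1) unfolding upath_def by auto
  have p0: "p \<noteq> []" using 1 P0(1) D by (cases p) auto
  have q0: "q \<noteq> []" using 2 P0(2) D by (cases q rule: rev_cases) auto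
  have Ep: "E (last p) d1" "successively E p"
    using P0(5) p0 unfolding 1(1) by (auto simp: successively_append_iff)
  have Eq: "E d2 (hd q)" "successively E q"
    using P0(5) q0 unfolding 2(1) by (auto simp: successively_append_iff successively_Cons)
  have lp: "last p \<in> {a, b}"
  proof -
    have "last p \<in> V" "last p \<notin> D" using 1 P0(4) p0 by auto
    then have "last p \<in> nbh V E D" using 1(2) sympD[OF GD(2) Ep(1)] unfolding nbh_def by blast
    then show ?thesis using N by blast
  qed
  have hq: "hd q \<in> {a, b}"
  proof -
    have "hd q \<in> V" "hd q \<notin> D" using 2 P0(4) q0 by auto
    then have "hd q \<in> nbh V E D" using 2(2) Eq(1) unfolding nbh_def by blast
    then show ?thesis using N by blast
  qed
  have "length p \<le> length s'"
  proof (rule ccontr)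
    assume "\<not> ?thesis"
    then have "d2 = p ! length s'" using 1(1) 2(1)
      by (metis not_le nth_append nth_append_length)
    then show False using 1(3) 2(2) \<open>\<not> length p \<le> length s'\<close> by auto
  qed
  then have "p = take (length p) s'" using 1(1) 2(1)
    by (metis append_eq_append_conv_if append_eq_conv_conj)
  then have "set p \<subseteq> set s'" by (metis set_take_subset)
  then have pq: "set p \<inter> set q = {}" using P0(3) unfolding 2(1) by auto
  have "last p \<noteq> hd q" using pq p0 q0 by (metis disjoint_iff last_in_set hd_in_set)
  then have "{last p, hd q} = {a, b}" using lp hq by auto
  moreover have "upath (V - D) E x p (last p)"
    using p0 P0 Ep 1 unfolding upath_def by auto
  moreover have "upath (V - D) E (hd q) q y"
    using q0 P0 Eq 2 unfolding upath_def by auto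
  ultimately show ?thesis using that pq by blast
qed

lemma cut_path:
  assumes G: "biconn V E x y" and D: "D \<noteq> {}" "D \<subseteq> V - {x, y}" and N: "nbh V E D \<subseteq> {a, b}"
  obtains r where "upath (D \<union> {a, b}) E a r b"
proof -
  note cp = cut_pair[OF G D N]
  have GI: "biconn (D \<union> {a, b}) E a b" by (rule cut_inner[OF G D]) (use cp N in auto)
  obtain d where "d \<in> D" using D by blast
  then show ?thesis using path_through[OF GI, of d] cp that by auto
qed

lemma lift_haspath:
  assumes G: "biconn V E x y" and D: "D \<noteq> {}" "D \<subseteq> V - {x, y}" and N: "nbh V E D \<subseteq> {a, b}"
    and hp: "haspath (V - D) (add_edge E a b) x y m"
  shows "haspath V E x y m"
proof -
  obtain p where p: "upath (V - D) (add_edge E a b) x p y" "m < length p"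
    using hp unfolding haspath_def by blast
  obtain r where r: "upath (D \<union> {a, b}) E a r b" by (rule cut_path[OF G D N])
  have V: "V - D \<union> D = V" using D by auto
  have "\<exists>q. upath (V - D \<union> D) E x q y \<and> length p \<le> length q \<and> set p \<subseteq> set q"
    using lift_path[OF p(1) r cut_pair(2)[OF G D N] biconnD(2)[OF G]] by auto
  then show ?thesis using p(2) unfolding V haspath_def by force
qed

lemma haspath_via:
  assumes p: "upath (V - D) E x p a" and q: "upath (V - D) E b q y" and pq: "set p \<inter> set q = {}"
    and D: "D \<subseteq> V" and hp: "haspath (D \<union> {a, b}) E a b m"
  shows "haspath V E x y (m + (length p - 1) + (length q - 1))"
proof -
  obtain r where r: "upath (D \<union> {a, b}) E a r b" "m < length r" using hp unfolding haspath_def by blast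
  have V: "V - D \<union> D = V" using D by auto
  have d: "(V - D) \<inter> D = {}" by auto
  have "p \<noteq> []" "q \<noteq> []" using p q unfolding upath_def by auto
  then have "length p \<ge> 1" "length q \<ge> 1" by (simp_all add: Suc_leI)
  then show ?thesis using upath_splice[OF p q pq r(1) d] r(2) unfolding V haspath_def
    by (intro exI[of _ "p @ butlast (tl r) @ q"]) auto
qed

lemma haspath_via_terminal_cut:
  assumes G: "biconn V E x y" and D: "D \<subseteq> V - {x, y}" 
    and q: "upath (V - D - {x}) E c q y" and hp: "haspath (D \<union> {x, c}) E x c m"
  shows "haspath V E x y (m + (length q - 1))"
proof -
  have "upath (V - D) E x [x] x" using biconnD[OF G] D unfolding upath_def by auto
  moreover have "upath (V - D) E c q y" by (rule upath_mono[OF q]) auto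
  moreover have "set [x] \<inter> set q = {}" using q unfolding upath_def by auto
  ultimately have "haspath V E x y (m + (length [x] - 1) + (length q - 1))"
    by (rule haspath_via) (use D hp in auto)
  then show ?thesis by simp
qed

text \<open>Having left \<open>D\<close> at \<open>c \<noteq> y\<close>, the path still needs an
  edge to reach \<open>y\<close>. This unit is what routing through a side at a terminal
  gains.\<close>

lemma haspath_via_terminal_cut_Suc:
  assumes G: "biconn V E x y" and D: "D \<noteq> {}" "D \<subseteq> V - {x, y}" and N: "nbh V E D \<subseteq> {x, c}" and c: "c \<noteq> y"
    and hp: "haspath (D \<union> {x, c}) E x c m"
  shows "haspath V E x y (Suc m)"
proof -
  note cp = cut_pair[OF G D N]
  obtain q where q: "upath (V - D - {x}) E c q y" using path_beyond_cut[OF G D(2)] cp N by blast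
  then have "2 \<le> length q" using c unfolding upath_def by (cases q; cases "tl q") auto
  then show ?thesis using haspath_mono[OF haspath_via_terminal_cut[OF G D(2) q hp]] by simp
qed

section \<open>Counting heavy vertices\<close>

lemma deg_less_card:
  assumes "finite V" "irreflp E" "v \<in> V"
  shows "deg V E v < card V"
  unfolding deg_def using assms by (intro psubset_card_mono) (auto simp: irreflp_def)

lemma heavy_finite: "biconn V E x y \<Longrightarrow> heavy V E x y k L \<Longrightarrow> finite L"
  unfolding heavy_def using biconnD(1) finite_subset by (metis finite_Diff)

lemma heavy_less_card:
  assumes "biconn V E x y" "heavy V E x y k L" "L \<noteq> {}"
  shows "k < card V"
proof -
  obtain v where "v \<in> L" using assms by blast
  then have "k \<le> deg V E v" "v \<in> V" using assms(2) unfolding heavy_def by auto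
  then show ?thesis using deg_less_card[of V E v] biconnD[OF assms(1)] by auto
qed

text \<open>The union \<open>{x, y} \<union> {a, b}\<close> is counted as a whole because a cut
  vertex may coincide with a terminal.\<close>

lemma card_cut:
  assumes G: "biconn V E x y" and H: "heavy V E x y k L" and D: "D \<noteq> {}" "D \<subseteq> V - {x, y}" 
    and N: "nbh V E D \<subseteq> {a, b}"
  shows "card (D \<union> {a, b}) = card D + 2" "card (V - D) + card D = card V" "0 < card D"
    "card D + card ({x, y} \<union> {a, b}) + card (V - D - {x, y, a, b}) = card V"
    "card L = card (L \<inter> D) + card (L - D - {a, b}) + card (L \<inter> {a, b})"
proof -
  note cp = cut_pair[OF G D N] and f = biconnD(1)[OF G]
  have fD: "finite D" using f D finite_subset by blast
  have fL: "finite L" by (rule heavy_finite[OF G H])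
  show "card (D \<union> {a, b}) = card D + 2" using cp fD by (subst card_Un_disjoint) auto
  show "card (V - D) + card D = card V"
    using card_Diff_subset[OF fD, of V] card_mono[OF f, of D] D by (metis Diff_subset le_add_diff_inverse2 subset_trans)
  show "0 < card D" using fD D by auto
  have "V = D \<union> (({x, y} \<union> {a, b}) \<union> (V - D - {x, y, a, b}))" using cp D biconnD[OF G] by auto
  then have "card V = card (D \<union> (({x, y} \<union> {a, b}) \<union> (V - D - {x, y, a, b})))" by metis
  also have "\<dots> = card D + card (({x, y} \<union> {a, b}) \<union> (V - D - {x, y, a, b}))"
    using fD f cp D by (intro card_Un_disjoint) auto
  also have "card (({x, y} \<union> {a, b}) \<union> (V - D - {x, y, a, b})) = card ({x, y} \<union> {a, b}) + card (V - D - {x, y, a, b})"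
    using f by (intro card_Un_disjoint) auto
  finally show "card D + card ({x, y} \<union> {a, b}) + card (V - D - {x, y, a, b}) = card V" by simp
  have "L = (L \<inter> D) \<union> ((L - D - {a, b}) \<union> (L \<inter> {a, b}))" using cp by auto
  then have "card L = card ((L \<inter> D) \<union> ((L - D - {a, b}) \<union> (L \<inter> {a, b})))" by metis
  also have "\<dots> = card (L \<inter> D) + card ((L - D - {a, b}) \<union> (L \<inter> {a, b}))"
    using fL cp by (intro card_Un_disjoint) auto
  also have "card ((L - D - {a, b}) \<union> (L \<inter> {a, b})) = card (L - D - {a, b}) + card (L \<inter> {a, b})"
    using fL by (intro card_Un_disjoint) auto
  finally show "card L = card (L \<inter> D) + card (L - D - {a, b}) + card (L \<inter> {a, b})" by simp
qed

text \<open>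
  No part of the graph is attached to the two terminals only, that is, removing both terminals leaves
  a connected graph.
\<close>

definition unsplit :: "'a set \<Rightarrow> ('a \<Rightarrow> 'a \<Rightarrow> bool) \<Rightarrow> 'a \<Rightarrow> 'a \<Rightarrow> bool" where
  "unsplit V E x y \<longleftrightarrow> (\<forall>D. D \<noteq> {} \<longrightarrow> D \<subset> V - {x, y} \<longrightarrow> \<not> nbh V E D \<subseteq> {x, y})"

text \<open>Suppose that \<open>y\<close> has no neighbour other than \<open>c\<close> among the
  vertices reachable from \<open>c\<close> within the remainder. Then the whole remainder is
  reachable, as an unreachable part would be attached to the terminals only. So the remainder does
  not touch \<open>y\<close> and is a second side of the cut \<open>{x, c}\<close>.\<close>

lemma long_path_or_split:
  assumes G: "biconn V E x y"
    and noY: "unsplit V E x y"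
    and D: "D \<noteq> {}" "D \<subseteq> V - {x, y}" and N: "nbh V E D \<subseteq> {x, c}" and c: "c \<noteq> y"
  shows "(\<exists>q. upath (V - D - {x}) E c q y \<and> 3 \<le> length q) \<or> nbh V E (V - D - {x, y, c}) \<subseteq> {x, c}"
proof -
  note cp = cut_pair[OF G D N]
  note sy = sympD[OF biconnD(2)[OF G]]
  define R where "R = V - D - {x, y, c}"
  define A where "A = reach (R \<union> {c}) E c"
  have A: "c \<in> A" "A \<subseteq> R \<union> {c}"
    unfolding A_def using reach_self[of c "R \<union> {c}" E] reach_subset[of "R \<union> {c}" E c] by auto
  have st: "w \<in> A" if "u \<in> A" "w \<in> R \<union> {c}" "E u w" for u w
    using that unfolding A_def by (rule reach_step)
  have RD: "\<not> E u w" if "u \<in> R" "w \<in> D" for u w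
    using that N sy unfolding R_def nbh_def by auto
  show ?thesis
  proof (cases "\<exists>a\<in>A. a \<noteq> c \<and> E a y")
    case True
    then obtain a p where a: "upath (R \<union> {c}) E c p a" "a \<noteq> c" "E a y" unfolding A_def reach_def by auto
    have sub: "R \<union> {c} \<subseteq> V - D - {x}" unfolding R_def using cp by auto
    have p: "upath (V - D - {x}) E c p a" by (rule upath_mono[OF a(1) sub])
    have y: "y \<in> V - D - {x}" using D biconnD[OF G] by auto
    have "y \<notin> set p" using a(1) c unfolding upath_def R_def by auto
    then have "upath (V - D - {x}) E c (p @ [y]) y"
      using upath_append[OF p, of y "[y]" y] y a(3) unfolding upath_def by auto
    moreover have "2 \<le> length p" using a unfolding upath_def by (cases p; cases "tl p") auto
    ultimately show ?thesis by (intro disjI1 exI[of _ "p @ [y]"]) auto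
  next
    case False
    have "R \<subseteq> A"
    proof (rule ccontr)
      assume "\<not> R \<subseteq> A"
      then have B: "R - A \<noteq> {}" by auto
      have "R - A \<subseteq> V - {x, y}" "c \<in> V - {x, y}" "c \<notin> R - A" using cp c A unfolding R_def by auto
      then have B': "R - A \<subset> V - {x, y}" by auto
      have "nbh V E (R - A) \<subseteq> {x, y}" unfolding nbh_subset_iff
      proof (intro ballI impI)
        fix u w assume u: "u \<in> R - A" "w \<in> V" "E u w"
        show "w \<in> R - A \<union> {x, y}"
        proof (rule ccontr)
          assume w: "w \<notin> R - A \<union> {x, y}"
          have "w \<notin> D" using RD u by auto
          then have "w \<in> A" using w u A(1) unfolding R_def by auto
          then show False using st[of w u] u sy by auto
        qed
      qed
      then show False using noY B B' unfolding unsplit_def by simp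
    qed
    then have "nbh V E R \<subseteq> {x, c}" unfolding nbh_subset_iff
      using False RD unfolding R_def by auto
    then show ?thesis unfolding R_def by blast
  qed
qed

text \<open>
  The two bounds of the simultaneous induction on the number of vertices. \<open>L\<close> may be any set of inner
  vertices of degree at least \<open>k\<close>; the vertices outside \<open>L\<close> are called light, whatever their degree.
  A light neighbour \<open>z\<close> of \<open>x\<close> improves the bound by one. This is what
  pays for a cut \<open>{x, c}\<close>: deleting the side \<open>D\<close> of the cut and adding the edge \<open>xc\<close> may destroy the
  degree of \<open>c\<close>, but then \<open>c\<close> becomes a light neighbour of \<open>x\<close>.
  All subtractions are truncated, and \<open>L \<noteq> {}\<close> is needed, as otherwise \<open>k\<close> would be unconstrained.
\<close>

locale path_bounds_below =
  fixes V :: "'a set"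
  assumes weak: "\<And>(W :: 'a set) E x y k L. card W < card V \<Longrightarrow> biconn W E x y \<Longrightarrow> heavy W E x y k L \<Longrightarrow> L \<noteq> {} \<Longrightarrow>
      haspath W E x y (k - (card W - 1 - 2 * card L))"
    and strong: "\<And>(W :: 'a set) E x y k L z. card W < card V \<Longrightarrow> biconn W E x y \<Longrightarrow> heavy W E x y k L \<Longrightarrow> L \<noteq> {} \<Longrightarrow>
      z \<in> W - {x, y} - L \<Longrightarrow> E x z \<Longrightarrow> haspath W E x y (k - (card W - 2 - 2 * card L))"
begin

section \<open>The induction hypothesis on both sides of a cut\<close>

lemma weak_inner:
  assumes G: "biconn V E x y" and H: "heavy V E x y k L" and D: "D \<noteq> {}" "D \<subseteq> V - {x, y}"
    and N: "nbh V E D \<subseteq> {a, b}" and lt: "card (D \<union> {a, b}) < card V" and L: "L \<inter> D \<noteq> {}"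
  shows "haspath (D \<union> {a, b}) E a b (k - (card D + 1 - 2 * card (L \<inter> D)))"
proof -
  note cp = cut_pair[OF G D N]
  have "biconn (D \<union> {a, b}) E a b" by (rule cut_inner[OF G D]) (use cp N in auto)
  moreover have "heavy (D \<union> {a, b}) E a b k (L \<inter> D)"
    by (rule heavy_inner[OF H D(2)]) (use cp N biconnD[OF G] in auto)
  ultimately show ?thesis using weak[OF lt _ _ L] card_cut(1)[OF G H D N] by fastforce
qed

lemma strong_inner:
  assumes G: "biconn V E x y" and H: "heavy V E x y k L" and D: "D \<noteq> {}" "D \<subseteq> V - {x, y}"
    and N: "nbh V E D \<subseteq> {a, b}" and lt: "card (D \<union> {a, b}) < card V" and L: "L \<inter> D \<noteq> {}"
    and z: "z \<in> D - L" "E a z"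
  shows "haspath (D \<union> {a, b}) E a b (k - (card D - 2 * card (L \<inter> D)))"
proof -
  note cp = cut_pair[OF G D N]
  have 1: "biconn (D \<union> {a, b}) E a b" by (rule cut_inner[OF G D]) (use cp N in auto)
  have 2: "heavy (D \<union> {a, b}) E a b k (L \<inter> D)"
    by (rule heavy_inner[OF H D(2)]) (use cp N biconnD[OF G] in auto)
  have "z \<in> D \<union> {a, b} - {a, b} - (L \<inter> D)" using z cp by auto
  then show ?thesis using strong[OF lt 1 2 L _ z(2)] card_cut(1)[OF G H D N] by auto
qed

lemma weak_outer:
  assumes G: "biconn V E x y" and H: "heavy V E x y k L" and D: "D \<noteq> {}" "D \<subseteq> V - {x, y}"
    and N: "nbh V E D \<subseteq> {a, b}" and L: "L - D - {a, b} \<noteq> {}"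
  shows "haspath V E x y (k - (card V - card D - 1 - 2 * card (L - D - {a, b})))"
proof -
  note cp = cut_pair[OF G D N]
  have "biconn (V - D) (add_edge E a b) x y"
    by (rule cut_outer[OF G D]) (use cp N L H in \<open>auto simp: heavy_def\<close>)
  then show ?thesis
    using lift_haspath[OF G D N weak[OF card_cut_outer[OF G D(2,1)] _ heavy_outer[OF H G N] L]]
      card_cut(2)[OF G H D N] by (metis diff_add_inverse2)
qed

lemma strong_outer:
  assumes G: "biconn V E x y" and H: "heavy V E x y k L" and D: "D \<noteq> {}" "D \<subseteq> V - {x, y}"
    and N: "nbh V E D \<subseteq> {x, c}" and c: "c \<noteq> y" and L: "L - D - {x, c} \<noteq> {}"
  shows "haspath V E x y (k - (card V - card D - 2 - 2 * card (L - D - {x, c})))"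
proof -
  note cp = cut_pair[OF G D N]
  have "biconn (V - D) (add_edge E x c) x y"
    by (rule cut_outer[OF G D]) (use cp N L H in \<open>auto simp: heavy_def\<close>)
  moreover have "c \<in> V - D - {x, y} - (L - D - {x, c})" "add_edge E x c x c"
    using cp c by (auto simp: add_edge_def)
  ultimately show ?thesis
    using lift_haspath[OF G D N strong[OF card_cut_outer[OF G D(2,1)] _ heavy_outer[OF H G N] L]]
      card_cut(2)[OF G H D N] by (metis diff_add_inverse2)
qed

text \<open>Since \<open>k < card V\<close>, the bound is at most three. It is three only if the
  heavy vertex is adjacent to all others, and then it can be inserted between \<open>z\<close> and
  \<open>y\<close>.\<close>

lemma strong_single:
  assumes G: "biconn V E x y" and H: "heavy V E x y k L" and L: "card L = 1"
    and z: "z \<in> V - {x, y} - L" "E x z"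
  shows "haspath V E x y (k - (card V - 2 - 2 * card L))"
proof -
  note GD = biconnD[OF G]
  obtain l where l: "L = {l}" using L by (metis card_1_singletonE)
  have lV: "l \<in> V - {x, y}" "k \<le> deg V E l" using H l unfolding heavy_def by auto
  have "card {x, y, z, l} = 4" using lV z l GD(6) by auto
  moreover have "{x, y, z, l} \<subseteq> V" using lV z GD by auto
  ultimately have n: "4 \<le> card V" using card_mono[OF GD(1)] by metis
  have kn: "k < card V" using heavy_less_card[OF G H] l by simp
  show ?thesis
  proof (cases "k + 2 \<le> card V")
    case True
    then show ?thesis using haspath_mono[OF haspath_2[OF G]] L n by simp
  next
    case False
    have fin: "finite (V - {l})" using GD by auto
    have sub: "{w \<in> V. E l w} \<subseteq> V - {l}" using GD(3) unfolding irreflp_def by auto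
    have "card (V - {l}) \<le> card {w \<in> V. E l w}" using False kn lV GD(1) unfolding deg_def by auto
    then have "{w \<in> V. E l w} = V - {l}" using card_seteq[OF fin sub] by simp
    then have "E l z" "E l y" using z l lV GD by auto
    then have "upath V E x [x, z, l, y] y"
      using z lV l GD sympD[OF GD(2)] unfolding upath_def by auto
    then have "haspath V E x y 3" unfolding haspath_def by (intro exI[of _ "[x, z, l, y]"]) auto
    moreover have "k - (card V - 2 - 2 * card L) \<le> 3" using kn L n by linarith
    ultimately show ?thesis by (rule haspath_mono)
  qed
qed

text \<open>The strong bound is available on both sides of the cut: inside through \<open>z\<close>,
  outside through \<open>c\<close>, which the new edge makes a light neighbour of \<open>x\<close>.
  One of them suffices unless \<open>D\<close> is a single light vertex whose removal costs a heavy
  \<open>c\<close> a neighbour that the edge \<open>xc\<close>, already present, cannot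
  replace.\<close>

lemma strong_cut_near:
  assumes G: "biconn V E x y" and H: "heavy V E x y k L" and L: "1 < card L"
    and D: "D \<noteq> {}" "D \<subseteq> V - {x, y}" and N: "nbh V E D \<subseteq> {x, c}" and c: "c \<noteq> y"
    and z: "z \<in> D - L" "E x z"
  shows "haspath V E x y (k - (card V - 2 - 2 * card L)) \<or> (\<exists>d. D = {d} \<and> c \<in> L \<and> E x c)"
proof -
  note GD = biconnD[OF G] and cp = cut_pair[OF G D N] and cc = card_cut[OF G H D N]
  have xL: "x \<notin> L" "y \<notin> L" using H unfolding heavy_def by auto
  have "L \<inter> {x, c} \<subseteq> {c}" using xL by auto
  then have lc: "card (L \<inter> {x, c}) \<le> 1" using card_mono[of "{c}" "L \<inter> {x, c}"] by simp
  have lc0: "card (L \<inter> {x, c}) = 0" if "c \<notin> L" using that xL by simp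
  have "card ({x, y} \<union> {x, c}) = 3" using cp c GD(6) by (simp add: insert_commute)
  then have n: "card D + 3 \<le> card V" using cc(4) by linarith
  have lt: "card (D \<union> {x, c}) < card V" using cc(1) n by simp
  show ?thesis
  proof (cases "L \<inter> D = {}")
    case False
    show ?thesis
    proof (cases "card D - 2 * card (L \<inter> D) \<le> (card V - 2 - 2 * card L) + 1")
      case True
      have "haspath V E x y (Suc (k - (card D - 2 * card (L \<inter> D))))"
        by (rule haspath_via_terminal_cut_Suc[OF G D N c strong_inner[OF G H D N lt False z]])
      then show ?thesis by (rule disjI1[OF haspath_mono]) (use True in linarith)
    next
      case big: False
      have "L - D - {x, c} \<noteq> {}"
      proof
        assume "L - D - {x, c} = {}"
        then have "card (L - D - {x, c}) = 0" by (simp only: card.empty)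
        then show False using big cc(5) lc n by linarith
      qed
      from strong_outer[OF G H D N c this] show ?thesis
        by (rule disjI1[OF haspath_mono]) (use big cc(5) lc n in linarith)
    qed
  next
    case LD: True
    have LDx: "L - D - {x, c} \<noteq> {}"
    proof
      assume "L - D - {x, c} = {}"
      then have "card (L - D - {x, c}) = 0" by (simp only: card.empty)
      then show False using LD cc(5) lc L by simp
    qed
    show ?thesis
    proof (cases "2 \<le> card D \<or> c \<notin> L")
      case True
      \<comment> \<open>Striking \<open>c\<close> from \<open>L\<close> costs two units, paid for by
        the removal of at least two light vertices.\<close>
      then have "2 * card (L \<inter> {x, c}) \<le> card D" using lc lc0 by fastforce
      then have "card V - card D - 2 - 2 * card (L - D - {x, c}) \<le> card V - 2 - 2 * card L"
        using LD cc(5) by simp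
      then show ?thesis using haspath_mono[OF strong_outer[OF G H D N c LDx]] by (metis diff_le_mono2)
    next
      case False
      then have "card D = 1" using cc(3) by linarith
      then obtain d where d: "D = {d}" by (metis card_1_singletonE)
      show ?thesis
      proof (cases "E x c")
        case True then show ?thesis using d False by blast
      next
        case nE: False
        have B: "biconn (V - D) (add_edge E x c) x y"
          by (rule cut_outer[OF G D]) (use cp N LDx H in \<open>auto simp: heavy_def\<close>)
        \<comment> \<open>In exchange for \<open>d\<close>, the vertex \<open>c\<close> gains the
          neighbour \<open>x\<close>. Nothing is struck from \<open>L\<close>, and the weak bound
          with one vertex less is the strong bound wanted here.\<close>
        have Hc: "k \<le> deg (V - D) (add_edge E x c) c"
        proof -
          have "\<not> E c x" using nE sympD[OF GD(2)] by blast
          have fin: "finite {w \<in> V. E c w}" using GD(1) by auto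
          have "k \<le> card {w \<in> V. E c w}" using H False unfolding heavy_def deg_def by auto
          also have "\<dots> \<le> Suc (card ({w \<in> V. E c w} - {d}))"
            using diff_card_le_card_Diff[of "{d}" "{w \<in> V. E c w}"] by simp
          also have "\<dots> = card (insert x ({w \<in> V. E c w} - {d}))"
            using fin \<open>\<not> E c x\<close> by (subst card_insert_disjoint) auto
          also have "\<dots> \<le> card {w \<in> V - D. add_edge E x c c w}"
            using GD(1) GD(4) D d by (intro card_mono) (auto simp: add_edge_def)
          finally show ?thesis unfolding deg_def .
        qed
        have "heavy (V - D) (add_edge E x c) x y k L"
          using heavy_outer[OF H G N] Hc H LD cp c unfolding heavy_def by blast
        from weak[OF card_cut_outer[OF G D(2,1)] B this] L
        have "haspath (V - D) (add_edge E x c) x y (k - (card (V - D) - 1 - 2 * card L))" by fastforce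
        from lift_haspath[OF G D N this] show ?thesis
          by (rule disjI1[OF haspath_mono]) (use cc(2) d in simp)
      qed
    qed
  qed
qed

text \<open>If all neighbours of \<open>x\<close> in \<open>D\<close> are heavy, only the weak bound
  is available inside \<open>D\<close>. Both routes then fail, by one unit, only if
  \<open>c \<in> L\<close> and \<open>card D = 2 * card (L \<inter> D) + ?t + 1\<close>. A longer
  exit from \<open>c\<close> to \<open>y\<close> supplies the unit; failing that, the remainder is
  another side of the same cut, and it contains the light neighbour \<open>z\<close>.\<close>

lemma strong_cut:
  assumes G: "biconn V E x y" and H: "heavy V E x y k L" and L: "1 < card L"
    and noY: "unsplit V E x y"
    and z: "z \<in> V - {x, y} - L" "E x z"
    and D: "D \<noteq> {}" "D \<subseteq> V - {x, y}" and N: "nbh V E D \<subseteq> {x, c}" and c: "c \<noteq> y"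
  shows "haspath V E x y (k - (card V - 2 - 2 * card L)) \<or> (\<exists>d. D = {d} \<and> d \<notin> L \<and> c \<in> L \<and> E x c)"
proof (cases "\<exists>z'\<in>D - L. E x z'")
  case True
  then show ?thesis using strong_cut_near[OF G H L D N c] by blast
next
  case far: False
  note GD = biconnD[OF G] and cp = cut_pair[OF G D N] and cc = card_cut[OF G H D N]
  have "x \<in> nbh V E D" using cp by auto
  then obtain l where "l \<in> D" "E l x" unfolding nbh_def by auto
  then have LD: "L \<inter> D \<noteq> {}" using far sympD[OF GD(2)] by blast
  have zD: "z \<notin> D" using far z by auto
  have xL: "x \<notin> L" "y \<notin> L" using H unfolding heavy_def by auto
  have "L \<inter> {x, c} \<subseteq> {c}" using xL by auto
  then have lc: "card (L \<inter> {x, c}) \<le> 1" using card_mono[of "{c}" "L \<inter> {x, c}"] by simp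
  have lc0: "card (L \<inter> {x, c}) = 0" if "c \<notin> L" using that xL by simp
  have "card ({x, y} \<union> {x, c}) = 3" using cp c GD(6) by (simp add: insert_commute)
  then have n: "card D + 3 + card (V - D - {x, y, x, c}) = card V" using cc(4) by linarith
  have lt: "card (D \<union> {x, c}) < card V" using cc(1) n by simp
  let ?t = "card V - 2 - 2 * card L"
  have W: "haspath (D \<union> {x, c}) E x c (k - (card D + 1 - 2 * card (L \<inter> D)))"
    by (rule weak_inner[OF G H D N lt LD])
  show ?thesis
  proof (cases "card D - 2 * card (L \<inter> D) \<le> ?t \<and> card D + 1 - 2 * card (L \<inter> D) \<le> ?t + 1")
    case True
    from haspath_via_terminal_cut_Suc[OF G D N c W] show ?thesis
      by (rule disjI1[OF haspath_mono]) (use True in linarith)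
  next
    case big: False
    then have D2: "2 * card (L \<inter> D) + ?t + 1 \<le> card D" by linarith
    show ?thesis
    proof (cases "c \<in> L \<and> card D = 2 * card (L \<inter> D) + ?t + 1")
      case False
      then have D3: "2 * card (L \<inter> D) + ?t + 2 * card (L \<inter> {x, c}) \<le> card D"
        using D2 lc lc0 by (cases "c \<in> L") auto
      have "L - D - {x, c} \<noteq> {}"
      proof
        assume "L - D - {x, c} = {}"
        then have "card (L - D - {x, c}) = 0" by (simp only: card.empty)
        then show False using D2 D3 cc(5) n by linarith
      qed
      from strong_outer[OF G H D N c this] show ?thesis
        by (rule disjI1[OF haspath_mono]) (use D3 cc(5) in linarith)
    next
      case True
      from long_path_or_split[OF G noY D N c] show ?thesis
      proof (elim disjE exE conjE)
        fix q assume q: "upath (V - D - {x}) E c q y" "3 \<le> length q"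
        from haspath_via_terminal_cut[OF G D(2) q(1) W] show ?thesis
          by (rule disjI1[OF haspath_mono]) (use True q(2) in linarith)
      next
        define R where "R = V - D - {x, y, c}"
        assume "nbh V E (V - D - {x, y, c}) \<subseteq> {x, c}"
        then have NR: "nbh V E R \<subseteq> {x, c}" by (simp add: R_def)
        have zR: "z \<in> R - L" using z zD True unfolding R_def by auto
        have R: "R \<noteq> {}" "R \<subseteq> V - {x, y}" using zR by (auto simp: R_def)
        from strong_cut_near[OF G H L R NR c zR z(2)] show ?thesis
        proof (elim disjE exE conjE)
          \<comment> \<open>Counting excludes the exceptional outcome: \<open>V\<close> would
            consist of \<open>D\<close> and four more vertices, of which at most \<open>c\<close> is
            in \<open>L\<close>, and this contradicts the assumed size of \<open>D\<close>.\<close>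
          fix d assume d: "R = {d}"
          have "card (V - D - {x, y, x, c}) = 1" using d unfolding R_def by (simp add: insert_commute)
          moreover have "card (L - D - {x, c}) = 0"
          proof -
            have "L - D - {x, c} \<subseteq> R - {z}" using H zR unfolding R_def heavy_def by auto
            then have "L - D - {x, c} = {}" using d zR by auto
            then show ?thesis by (simp only: card.empty)
          qed
          ultimately show ?thesis using True n cc(5) lc by linarith
        qed auto
      qed
    qed
  qed
qed

end

section \<open>Moving to a light neighbour\<close>

lemma haspath_step:
  assumes "haspath (V - {x}) E x' y (k - 1 - m)" "x \<in> V" "E x x'"
  shows "haspath V E x y (k - m)"
  by (rule haspath_mono[OF haspath_Cons[OF assms]]) simp

lemma card_remove: "finite V \<Longrightarrow> x \<in> V \<Longrightarrow> card (V - {x}) = card V - 1"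
  by simp

lemma deg_Diff_le:
  assumes "finite V"
  shows "deg V E v \<le> Suc (deg (V - {x}) E v)"
proof -
  have "{w \<in> V - {x}. E v w} = {w \<in> V. E v w} - {x}" by auto
  then show ?thesis
    unfolding deg_def using diff_card_le_card_Diff[of "{x}" "{w \<in> V. E v w}"] by simp
qed

lemma heavy_remove:
  assumes H: "heavy V E x y k L" and f: "finite V"
  shows "heavy (V - {x}) E x' y (k - 1) (L - {x'})"
proof -
  have "k - 1 \<le> deg (V - {x}) E v" if "v \<in> L" for v
    using H that deg_Diff_le[OF f, of E v x] unfolding heavy_def by fastforce
  then show ?thesis using H unfolding heavy_def by auto
qed

lemma split_complement:
  assumes G: "biconn V E x y" and D: "D \<subset> V - {x, y}" and N: "nbh V E D \<subseteq> {x, y}"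
  shows "nbh V E (V - {x, y} - D) \<subseteq> {x, y}" "V - {x, y} - D \<noteq> {}" "V - {x, y} - D \<subseteq> V - {x, y}"
    "card D + 2 < card V" "card (V - {x, y} - D) + card D + 2 = card V"
proof -
  note GD = biconnD[OF G]
  show "nbh V E (V - {x, y} - D) \<subseteq> {x, y}"
    using N sympD[OF GD(2)] D unfolding nbh_subset_iff by blast
  show ne: "V - {x, y} - D \<noteq> {}" and "V - {x, y} - D \<subseteq> V - {x, y}" using D by auto
  have fD: "finite D" using D GD(1) finite_subset by blast
  have "card (V - {x, y}) = card V - 2" "2 \<le> card V"
    using GD card_Diff_subset[of "{x, y}" V] card_mono[of V "{x, y}"] by auto
  moreover have "card (V - {x, y} - D) = card (V - {x, y}) - card D"
    using fD D by (intro card_Diff_subset) auto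
  moreover have "card D < card (V - {x, y})" using D GD(1) by (intro psubset_card_mono) auto
  ultimately show "card D + 2 < card V" "card (V - {x, y} - D) + card D + 2 = card V" by auto
qed

lemma card_heavy_split:
  assumes "heavy V E x y k L" "finite L" "D \<subseteq> V - {x, y}"
  shows "card L = card (L \<inter> D) + card (L \<inter> (V - {x, y} - D))"
proof -
  have "L = (L \<inter> D) \<union> (L \<inter> (V - {x, y} - D))" using assms unfolding heavy_def by auto
  then have "card L = card ((L \<inter> D) \<union> (L \<inter> (V - {x, y} - D)))" by metis
  also have "\<dots> = card (L \<inter> D) + card (L \<inter> (V - {x, y} - D))"
    using assms(2) by (intro card_Un_disjoint) auto
  finally show ?thesis .
qed

lemma unsplitD:
  assumes "unsplit V E x y" "D \<noteq> {}" "D \<subset> V - {x, y}" "nbh V E D \<subseteq> {x, c}"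
  shows "c \<noteq> y"
proof
  assume "c = y"
  then have "nbh V E D \<subseteq> {x, y}" using assms(4) by simp
  then show False using assms(1-3) unfolding unsplit_def by simp
qed

lemma haspath_inner: "haspath (D \<union> {x, y}) E x y m \<Longrightarrow> biconn V E x y \<Longrightarrow> D \<subseteq> V \<Longrightarrow> haspath V E x y m"
  by (erule haspath_subset) (auto dest: biconnD)

text \<open>
  The only obstructions to the induction step from \<open>x\<close> to a light neighbour that cut reductions
  do not remove: light triangles \<open>x, d, c\<close> with \<open>d\<close> of degree two.
\<close>

definition pendant :: "'a set \<Rightarrow> ('a \<Rightarrow> 'a \<Rightarrow> bool) \<Rightarrow> 'a \<Rightarrow> 'a \<Rightarrow> 'a set \<Rightarrow> 'a \<Rightarrow> 'a \<Rightarrow> bool" where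
  "pendant V E x y L d c \<longleftrightarrow> d \<in> V - {x, y} - L \<and> nbh V E {d} \<subseteq> {x, c} \<and> c \<in> L \<and> E x c"

context path_bounds_below
begin

text \<open>Moving to a light vertex keeps all of \<open>L\<close>. The deletion of \<open>x\<close>
  lowers degrees by at most one, which the edge \<open>xz\<close> makes up for, while the deficit
  falls with the number of vertices.\<close>

lemma strong_start:
  assumes G: "biconn V E x y" and H: "heavy V E x y k L" and L: "L \<noteq> {}"
    and z: "z \<in> V - {x, y} - L" "E x z" and B: "biconn (V - {x}) E z y"
  shows "haspath V E x y (k - (card V - 2 - 2 * card L))"
proof (rule haspath_step)
  note GD = biconnD[OF G]
  have "heavy (V - {x}) E z y (k - 1) L" using heavy_remove[OF H GD(1), of z] z by auto
  then have "haspath (V - {x}) E z y (k - 1 - (card (V - {x}) - 1 - 2 * card L))"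
    using weak[OF _ B _ L, where k = "k - 1"] card_remove[OF GD(1,4)] biconn_card[OF G] by simp
  then show "haspath (V - {x}) E z y (k - 1 - (card V - 2 - 2 * card L))"
    by (rule haspath_mono) (use card_remove[OF GD(1,4)] in simp)
qed (use z biconnD[OF G] in auto)

text \<open>
  After removing \<open>x\<close>, all pendant vertices are merged into the start vertex \<open>d1\<close>, so that their
  neighbours in \<open>L\<close> lose just one neighbour, namely \<open>x\<close>. A path starting with a merged edge \<open>d1 c\<close>
  is turned into one starting with \<open>x, d, c\<close> for the original \<open>d\<close>.
\<close>

lemma strong_merge:
  assumes G: "biconn V E x y" and H: "heavy V E x y k L" and L: "L \<noteq> {}"
    and ns: "unsplit V E x y"
    and cuts: "\<And>D c. D \<noteq> {} \<Longrightarrow> D \<subseteq> V - {x, y} \<Longrightarrow> nbh V E D \<subseteq> {x, c} \<Longrightarrow> c \<noteq> y \<Longrightarrow>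
      \<exists>d. D = {d} \<and> pendant V E x y L d c"
    and d1: "pendant V E x y L d1 c1" and d2: "pendant V E x y L d2 c2" "d1 \<noteq> d2"
  shows "haspath V E x y (k - (card V - 2 - 2 * card L))"
proof -
  note GD = biconnD[OF G] and sy = sympD[OF biconnD(2)[OF G]]
  define P where "P = pendant V E x y L"
  define J where "J = {d. \<exists>c. P d c}"
  define C where "C = {c. \<exists>d. P d c}"
  define W where "W = V - {x} - (J - {d1})"
  define F where "F u v \<longleftrightarrow> E u v \<or> u = d1 \<and> v \<in> C \<or> v = d1 \<and> u \<in> C" for u v
  have PD: "d \<in> V - {x, y} - L" "nbh V E {d} = {x, c}" "c \<in> L" "E x c" "c \<noteq> y" "c \<noteq> x" "c \<in> V" "E x d" "E d c"
    if "P d c" for d c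
  proof -
    show 1: "d \<in> V - {x, y} - L" "c \<in> L" "E x c" using that unfolding P_def pendant_def by auto
    then show "c \<noteq> y" "c \<noteq> x" "c \<in> V" using H unfolding heavy_def by auto
    show n: "nbh V E {d} = {x, c}" using cut_pair(1)[OF G, of "{d}" x c] that 1 unfolding P_def pendant_def by auto
    have "x \<in> nbh V E {d}" "c \<in> nbh V E {d}" using n by auto
    then show "E x d" "E d c" unfolding nbh_def using sy by auto
  qed
  have adj: "w = x \<or> w = c" if "P d c" "w \<in> V" "E d w" for d c w
  proof -
    have "w \<noteq> d" using that GD(3) unfolding irreflp_def by auto
    then have "w \<in> nbh V E {d}" using that unfolding nbh_def by auto
    then show ?thesis using PD(2)[OF that(1)] by auto
  qed
  \<comment> \<open>Two pendant vertices at the same \<open>c\<close> would form a two-element side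
    of the cut \<open>{x, c}\<close>, which \<open>cuts\<close> rules out.\<close>
  have uniq: "d = d'" if dd: "P d c" "P d' c" for d d' c
  proof -
    have "{d, d'} \<noteq> {}" "{d, d'} \<subseteq> V - {x, y}" using PD(1)[OF dd(1)] PD(1)[OF dd(2)] by auto
    moreover have "nbh V E {d, d'} \<subseteq> {x, c}"
      unfolding nbh_subset_iff using adj[OF dd(1)] adj[OF dd(2)] by auto
    ultimately have "\<exists>e. {d, d'} = {e}" using cuts[of "{d, d'}" c] PD(5)[OF dd(1)] by blast
    then show ?thesis by auto
  qed
  have Pd: "P d1 c1" "P d2 c2" using d1 d2 unfolding P_def by auto
  have JL: "J \<inter> L = {}" "J \<subseteq> V - {x, y}" "C \<subseteq> L" using PD unfolding J_def C_def by auto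
  have d1C: "d1 \<notin> C" and d1V: "d1 \<in> V - {x, y}" using PD(1)[OF Pd(1)] JL by auto
  have LW: "L \<subseteq> W - {d1, y}" using JL H PD(1)[OF Pd(1)] unfolding W_def heavy_def by auto
  have fW: "finite W" using GD(1) unfolding W_def by auto
  have BW: "biconn W F d1 y"
  proof (rule biconnI)
    show "symp F" using GD(2) unfolding F_def symp_def by blast
    show "irreflp F" using GD(3) d1C unfolding F_def irreflp_def by blast
    show "d1 \<in> W" "y \<in> W" "d1 \<noteq> y" using d1V GD JL unfolding W_def by auto
    show "W - {d1, y} \<noteq> {}" using LW L by auto
    fix D c assume D: "D \<noteq> {}" "D \<subseteq> W - {d1, y}" "nbh W F D \<subseteq> {c}"
    have DV: "D \<subseteq> V - {x, y}" "d1 \<notin> D" using D unfolding W_def by auto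
    have FD: "w \<in> D \<or> w = c" if "u \<in> D" "w \<in> W" "F u w" for u w
      using D(3) that unfolding nbh_subset_iff by auto
    show False
    proof (cases "D \<inter> C = {}")
      case True
      have N: "nbh V E D \<subseteq> {x, c}" unfolding nbh_subset_iff
      proof (intro ballI impI)
        fix u w assume u: "u \<in> D" "w \<in> V" "E u w"
        show "w \<in> D \<union> {x, c}"
        proof (cases "w \<in> W")
          case True then show ?thesis using FD[of u w] u unfolding F_def by auto
        next
          case False
          have "w = x"
          proof (rule ccontr)
            assume "w \<noteq> x"
            then have "w \<in> J" using False u unfolding W_def by auto
            then obtain c' where "P w c'" unfolding J_def by auto
            then have "u = c'" using adj[of w c' u] sy[OF u(3)] u(1) DV by auto
            then show False using \<open>P w c'\<close> True u(1) unfolding C_def by auto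
          qed
          then show ?thesis by simp
        qed
      qed
      show False
      proof (cases "c = y")
        case True
        have "D \<subset> V - {x, y}" using DV d1V by auto
        then show False using ns N D(1) True unfolding unsplit_def by auto
      next
        case False
        from cuts[OF D(1) DV(1) N this] obtain d where "D = {d}" "P d c" unfolding P_def by auto
        then show False using D(2) unfolding W_def J_def by auto
      qed
    next
      case False
      then obtain c' where c': "c' \<in> D" "c' \<in> C" by auto
      have "d1 = c" using FD[of c' d1] c' DV(2) d1V unfolding F_def W_def by auto
      \<comment> \<open>With the merged pendant vertices attached to \<open>D\<close> put back, the
        set has no outside neighbour in the old graph except \<open>x\<close>.\<close>
      define K where "K = {d \<in> J. \<exists>c\<in>D. P d c}"
      show False
      proof (rule biconn_no_cut[OF G, of "D \<union> K" x])
        show "D \<union> K \<noteq> {}" "D \<union> K \<subseteq> V - {x, y}" using D DV JL unfolding K_def by auto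
        fix u w assume u: "u \<in> D \<union> K" "w \<in> V" "E u w" "w \<notin> D \<union> K"
        show "w = x"
        proof (cases "u \<in> D")
          case True
          show ?thesis
          proof (rule ccontr)
            assume "w \<noteq> x"
            have "w \<in> J"
            proof (cases "w \<in> W")
              case True
              then have "w = c" using FD[of u w] u \<open>u \<in> D\<close> unfolding F_def by auto
              then show ?thesis using \<open>d1 = c\<close> Pd unfolding J_def by auto
            next
              case False then show ?thesis using u \<open>w \<noteq> x\<close> unfolding W_def by auto
            qed
            then obtain c' where "P w c'" unfolding J_def by auto
            then have "u = c'" using adj[of w c' u] sy[OF u(3)] True DV by auto
            then show False using u(4) \<open>P w c'\<close> True unfolding K_def J_def by auto
          qed
        next
          case False
          then obtain c' where "P u c'" "c' \<in> D" using u unfolding K_def by auto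
          then show ?thesis using adj[of u c' w] u by auto
        qed
      qed
    qed
  qed (rule fW)
  have HW: "heavy W F d1 y (k - 1) L"
  proof -
    have "k - 1 \<le> deg W F v" if v: "v \<in> L" for v
    proof -
      have kv: "k \<le> card {w \<in> V. E v w}" using H v unfolding heavy_def deg_def by auto
      have vV: "v \<in> V - {x, y}" using H v unfolding heavy_def by auto
      have fN: "finite {w \<in> W. F v w}" using fW by auto
      have JC: "P w v" if w: "w \<in> J" "E v w" for w
      proof -
        obtain c' where "P w c'" using w unfolding J_def by auto
        then show ?thesis using adj[of w c' v] sy[OF w(2)] vV by auto
      qed
      show ?thesis
      proof (cases "\<exists>d. P d v \<and> d \<noteq> d1")
        case False
        have "{w \<in> V. E v w} \<subseteq> insert x {w \<in> W. F v w}"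
          using JC False unfolding W_def F_def by auto
        then have "card {w \<in> V. E v w} \<le> card (insert x {w \<in> W. F v w})"
          using fN by (intro card_mono) auto
        also have "\<dots> \<le> Suc (card {w \<in> W. F v w})" by (rule card_insert_le_m1) auto
        finally show ?thesis using kv unfolding deg_def by simp
      next
        case True
        then obtain d where d: "P d v" "d \<noteq> d1" by blast
        \<comment> \<open>By \<open>uniq\<close> the vertex \<open>v\<close> has no pendant
          neighbour besides \<open>d\<close>. It loses \<open>x\<close> and \<open>d\<close> and
          gains \<open>d1\<close>, a net loss of one.\<close>
        have "\<not> E v d1" using JC[of d1] uniq[OF d(1), of d1] Pd(1) d(2) unfolding J_def by auto
        have sub: "{w \<in> V. E v w} \<subseteq> insert x (insert d ({w \<in> W. F v w} - {d1}))"
          using JC uniq[OF d(1)] \<open>\<not> E v d1\<close> unfolding W_def F_def by auto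
        have "d1 \<in> {w \<in> W. F v w}" using d(1) d1V unfolding F_def C_def W_def by auto
        then have c1: "Suc (card ({w \<in> W. F v w} - {d1})) = card {w \<in> W. F v w}"
          by (rule card_Suc_Diff1[OF fN])
        have "card {w \<in> V. E v w} \<le> card (insert x (insert d ({w \<in> W. F v w} - {d1})))"
          using fN sub by (intro card_mono) auto
        also have "\<dots> \<le> Suc (Suc (card ({w \<in> W. F v w} - {d1})))"
          by (intro card_insert_le_m1) auto
        finally show ?thesis using kv c1 unfolding deg_def by simp
      qed
    qed
    then show ?thesis using LW unfolding heavy_def by auto
  qed
  have cW: "card W + 2 \<le> card V"
  proof -
    have "W \<subseteq> V - {x, d2}" using Pd d2 unfolding W_def J_def by auto
    then have "card W \<le> card (V - {x, d2})" using GD(1) by (intro card_mono) auto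
    also have "\<dots> = card V - 2" using GD PD(1)[OF Pd(2)] by (subst card_Diff_subset) auto
    finally show ?thesis using biconn_card[OF G] by simp
  qed
  then have "haspath W F d1 y (k - 1 - (card W - 1 - 2 * card L))" using weak[OF _ BW HW L] by simp
  then obtain p where p: "upath W F d1 p y" "k - 1 - (card W - 1 - 2 * card L) < length p"
    unfolding haspath_def by blast
  obtain v q where q: "p = d1 # v # q"
    using p(1) BW unfolding upath_def biconn_def by (cases p; cases "tl p") auto
  have sq: "successively E (v # q)"
  proof (rule successively_mono[of F])
    show "successively F (v # q)" using p(1) unfolding q upath_def by auto
    fix a b assume "a \<in> set (v # q)" "b \<in> set (v # q)" "F a b"
    moreover have "d1 \<notin> set (v # q)" using p(1) unfolding q upath_def by auto
    ultimately show "E a b" unfolding F_def by auto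
  qed
  obtain d where d: "d = d1 \<or> d \<in> J" "E d v"
  proof -
    have "F d1 v" using p(1) unfolding q upath_def by auto
    then consider "E d1 v" | "v \<in> C" using d1C unfolding F_def by auto
    then show ?thesis using that PD(9) unfolding C_def J_def by cases auto
  qed
  have dJ: "d \<in> J" using d Pd unfolding J_def by auto
  have dx: "E x d" "d \<in> V" "d \<noteq> x" using dJ PD(1,8) unfolding J_def by auto
  \<comment> \<open>Among the pendant vertices \<open>W\<close> retains only \<open>d1\<close>,
    which the simple path \<open>p\<close> has already used as its start.\<close>
  have "d \<notin> set (v # q)" using p(1) dJ unfolding q upath_def W_def by auto
  moreover have "x \<notin> set (v # q)" "set (v # q) \<subseteq> V" using p(1) unfolding q upath_def W_def by auto
  ultimately have "upath V E x (x # d # v # q) y"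
    using p(1) sq d(2) dx GD(4) unfolding q upath_def by auto
  then show ?thesis unfolding haspath_def
    by (intro exI[of _ "x # d # v # q"]) (use p(2) cW in \<open>auto simp: q\<close>)
qed

text \<open>If no reduction applies, then for every light neighbour \<open>w\<close> of
  \<open>x\<close> the cut that blocks moving to \<open>w\<close> yields a pendant vertex different
  from \<open>w\<close>. A pendant vertex is itself a light neighbour of \<open>x\<close>, so doing
  this for \<open>z\<close> and then for the vertex found gives two distinct ones, as merging
  demands.\<close>

lemma strong_step:
  assumes G: "biconn V E x y" and H: "heavy V E x y k L" and L: "L \<noteq> {}"
    and z: "z \<in> V - {x, y} - L" "E x z"
  shows "haspath V E x y (k - (card V - 2 - 2 * card L))"
proof (cases "card L = 1")
  case True
  then show ?thesis using strong_single[OF G H _ z] by simp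
next
  case l1: False
  note GD = biconnD[OF G]
  have fL: "finite L" by (rule heavy_finite[OF G H])
  have "0 < card L" using L fL by (simp add: card_gt_0_iff)
  then have L1: "1 < card L" using l1 by linarith
  show ?thesis
  proof (cases "unsplit V E x y")
    case False
    then obtain D0 where D0: "D0 \<noteq> {}" "D0 \<subset> V - {x, y}" "nbh V E D0 \<subseteq> {x, y}"
      unfolding unsplit_def by blast
    \<comment> \<open>\<open>D\<close> is chosen as a side without \<open>z\<close>, so that the
      strong bound is available on the other side \<open>R\<close>.\<close>
    obtain D where D: "D \<noteq> {}" "D \<subset> V - {x, y}" "nbh V E D \<subseteq> {x, y}" "z \<notin> D"
    proof (cases "z \<in> D0")
      case False then show ?thesis using that D0 by blast
    next
      case True
      note sc = split_complement[OF G D0(2,3)]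
      have "V - {x, y} - D0 \<subset> V - {x, y}" using D0 by auto
      then show ?thesis using that[of "V - {x, y} - D0"] sc True by auto
    qed
    define R where "R = V - {x, y} - D"
    note sc = split_complement[OF G D(2,3), folded R_def]
    have DV: "D \<subseteq> V - {x, y}" using D by auto
    have cl: "card L = card (L \<inter> D) + card (L \<inter> R)"
      unfolding R_def by (rule card_heavy_split[OF H fL DV])
    have zR: "z \<in> R - L" using z D(4) unfolding R_def by auto
    have ltD: "card (D \<union> {x, y}) < card V" using card_cut(1)[OF G H D(1) DV D(3)] sc(4) by simp
    have "0 < card D" using card_cut(3)[OF G H D(1) DV D(3)] .
    then have ltR: "card (R \<union> {x, y}) < card V" using card_cut(1)[OF G H sc(2,3,1)] sc(5) by simp
    have Rpos: "0 < card R" using card_cut(3)[OF G H sc(2,3,1)] .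
    show ?thesis
    proof (cases "L \<inter> R \<noteq> {} \<and> card R - 2 * card (L \<inter> R) \<le> card V - 2 - 2 * card L")
      case True
      then have "haspath (R \<union> {x, y}) E x y (k - (card R - 2 * card (L \<inter> R)))"
        using strong_inner[OF G H sc(2,3,1) ltR _ zR z(2)] by blast
      from haspath_inner[OF this G] sc(3) have "haspath V E x y (k - (card R - 2 * card (L \<inter> R)))" by blast
      then show ?thesis by (rule haspath_mono) (use True in linarith)
    next
      case big: False
      have LD: "L \<inter> D \<noteq> {}"
      proof
        assume "L \<inter> D = {}"
        then have "card (L \<inter> D) = 0" by (simp only: card.empty)
        moreover have "L \<inter> R \<noteq> {}" using \<open>L \<inter> D = {}\<close> L cl calculation fL by force
        ultimately show False using big cl sc(5) by linarith
      qed
      have "card D + 1 - 2 * card (L \<inter> D) \<le> card V - 2 - 2 * card L"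
      proof (cases "L \<inter> R = {}")
        case True
        then have "card (L \<inter> R) = 0" by (simp only: card.empty)
        then show ?thesis using cl sc(5) Rpos by linarith
      next
        case False then show ?thesis using big cl sc(5) by linarith
      qed
      then have le: "k - (card V - 2 - 2 * card L) \<le> k - (card D + 1 - 2 * card (L \<inter> D))"
        by (rule diff_le_mono2)
      have "haspath V E x y (k - (card D + 1 - 2 * card (L \<inter> D)))"
        by (rule haspath_inner[OF weak_inner[OF G H D(1) DV D(3) ltD LD] G]) (use DV in auto)
      then show ?thesis using le by (rule haspath_mono)
    qed
  next
    case ns: True
    show ?thesis
    proof (rule ccontr)
      assume neg: "\<not> ?thesis"
      have cuts: "\<exists>d. D = {d} \<and> pendant V E x y L d c"
        if "D \<noteq> {}" "D \<subseteq> V - {x, y}" "nbh V E D \<subseteq> {x, c}" "c \<noteq> y" for D c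
        using strong_cut[OF G H L1 ns z that] neg that unfolding pendant_def by auto
      have ex: "\<exists>d c. pendant V E x y L d c \<and> d \<noteq> w" if w: "w \<in> V - {x, y} - L" "E x w" for w
      proof -
        have "L \<subseteq> V - {x, w, y}" using w H unfolding heavy_def by auto
        then have ne: "V - {x, w, y} \<noteq> {}" using L by auto
        have "\<not> biconn (V - {x}) E w y" using strong_start[OF G H L w] neg by blast
        then obtain D c where D: "D \<noteq> {}" "D \<subseteq> V - {x, w, y}" "nbh V E D \<subseteq> {x, c}"
          using step_or_cut[OF G _ ne] w by blast
        have "D \<subset> V - {x, y}" using D(2) w by auto
        then have "c \<noteq> y" using unsplitD[OF ns D(1) _ D(3)] by simp
        moreover have "D \<subseteq> V - {x, y}" using D(2) by auto
        ultimately obtain d where "D = {d}" "pendant V E x y L d c" using cuts[OF D(1) _ D(3)] by blast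
        then show ?thesis using D(2) by auto
      qed
      obtain d1 c1 where d1: "pendant V E x y L d1 c1" using ex[OF z] by blast
      have "x \<in> nbh V E {d1}" using cut_pair(1)[OF G, of "{d1}" x c1] d1 unfolding pendant_def by auto
      then have "E x d1" using sympD[OF GD(2)] unfolding nbh_def by auto
      then obtain d2 c2 where "pendant V E x y L d2 c2" "d2 \<noteq> d1" using ex[of d1] d1 unfolding pendant_def by auto
      then show False using strong_merge[OF G H L ns cuts d1] neg by blast
    qed
  qed
qed

end

section \<open>Long paths between two terminals\<close>

text \<open>A set \<open>D2\<close> obstructing the deletion of \<open>d\<close> has all its
  neighbours in \<open>{d, c2}\<close>. Depending on how \<open>D2\<close> meets
  \<open>{a, b}\<close>, either \<open>D \<union> D2\<close> or \<open>D2\<close> has at most one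
  outside neighbour, against biconnectivity, or \<open>D \<inter> D2\<close> or
  \<open>D - {d}\<close> is a smaller set with at most two, against minimality.\<close>

lemma biconn_delete_from_minimal_cut:
  assumes G: "biconn V E x y" and D: "D \<subseteq> V - {x, y}" and N: "nbh V E D \<subseteq> {a, b}"
    and min: "\<And>D' a' b'. D' \<noteq> {} \<Longrightarrow> D' \<subset> D \<Longrightarrow> \<not> nbh V E D' \<subseteq> {a', b'}"
    and d: "d \<in> D" "D \<noteq> {d}"
  shows "biconn (V - {d}) E x y"
proof (rule biconnI)
  note GD = biconnD[OF G] and sy = sympD[OF biconnD(2)[OF G]]
  note cp = cut_pair[OF G _ D N]
  have ND: "w \<in> D \<or> w = a \<or> w = b" if "u \<in> D" "w \<in> V" "E u w" for u w
    using N that unfolding nbh_subset_iff by auto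
  show "V - {d} - {x, y} \<noteq> {}" using D d by auto
  fix D2 c2 assume D2: "D2 \<noteq> {}" "D2 \<subseteq> V - {d} - {x, y}" "nbh (V - {d}) E D2 \<subseteq> {c2}"
  have N2: "w \<in> D2 \<or> w = d \<or> w = c2" if "u \<in> D2" "w \<in> V" "E u w" for u w
    using D2(3) that unfolding nbh_subset_iff by auto
  have D2V: "D2 \<subseteq> V - {x, y}" "d \<notin> D2" using D2 by auto
  have ab: "a \<in> V" "b \<in> V" "a \<notin> D" "b \<notin> D" "a \<noteq> b" using cp d by auto
  have one: False if h: "a' \<in> D2" "b' \<notin> D2" "{a', b'} = {a, b}" for a' b'
  proof -
    have ND': "w \<in> D \<or> w = a' \<or> w = b'" if "u \<in> D" "w \<in> V" "E u w" for u w
      using ND[OF that] h(3) by auto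
    have ab': "a' \<notin> D" "b' \<notin> D" "a' \<in> V" "b' \<in> V" using h(3) ab by (auto simp: doubleton_eq_iff)
    show False
    proof (cases "c2 \<in> D \<or> c2 = b'")
      case True
      show False
      proof (rule biconn_no_cut[OF G, of "D \<union> D2" b'])
        fix u w assume u: "u \<in> D \<union> D2" "w \<in> V" "E u w" "w \<notin> D \<union> D2"
        then show "w = b'" using ND'[of u w] N2[of u w] h(1) True d by auto
      qed (use D2 D in auto)
    next
      case False
      have "D \<inter> D2 = {}"
      proof (rule ccontr)
        assume ne: "D \<inter> D2 \<noteq> {}"
        have "nbh V E (D \<inter> D2) \<subseteq> {d, a'}" unfolding nbh_subset_iff
        proof (intro ballI impI)
          fix u w assume u: "u \<in> D \<inter> D2" "w \<in> V" "E u w"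
          then show "w \<in> D \<inter> D2 \<union> {d, a'}" using ND'[of u w] N2[of u w] False h(2) d ab' by auto
        qed
        moreover have "D \<inter> D2 \<subset> D" using d D2V by auto
        ultimately show False using min[of "D \<inter> D2" d a'] ne by auto
      qed
      have "nbh V E (D - {d}) \<subseteq> {d, b'}" unfolding nbh_subset_iff
      proof (intro ballI impI)
        fix u w assume u: "u \<in> D - {d}" "w \<in> V" "E u w"
        have "w \<noteq> a'"
        proof
          assume "w = a'"
          then have "u \<in> D2 \<or> u = d \<or> u = c2" using N2[of w u] h(1) u sy[OF u(3)] D by auto
          then show False using u \<open>D \<inter> D2 = {}\<close> False by auto
        qed
        then show "w \<in> D - {d} \<union> {d, b'}" using ND'[of u w] u by auto
      qed
      moreover have "D - {d} \<subset> D" "D - {d} \<noteq> {}" using d by auto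
      ultimately show False using min[of "D - {d}" d b'] by auto
    qed
  qed
  show False
  proof (cases "a \<in> D2")
    case aD: True
    show False
    proof (cases "b \<in> D2")
      case True
      show False
      proof (rule biconn_no_cut[OF G, of "D \<union> D2" c2])
        fix u w assume u: "u \<in> D \<union> D2" "w \<in> V" "E u w" "w \<notin> D \<union> D2"
        then show "w = c2" using ND[of u w] N2[of u w] aD True d by auto
      qed (use D2 D in auto)
    next
      case False then show False using one[of a b] aD by auto
    qed
  next
    case aD: False
    show False
    proof (cases "b \<in> D2")
      case True then show False using one[of b a] aD by auto
    next
      case bD: False
      show False
      proof (cases "D \<inter> D2 = {}")
        case True
        show False
        proof (rule biconn_no_cut[OF G D2(1) D2V(1), of c2])
          fix u w assume u: "u \<in> D2" "w \<in> V" "E u w" "w \<notin> D2"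
          have "w \<noteq> d" using ND[of d u] u sy[OF u(3)] D2V True aD bD d by auto
          then show "w = c2" using N2[of u w] u by auto
        qed
      next
        case False
        have "nbh V E (D \<inter> D2) \<subseteq> {d, c2}" unfolding nbh_subset_iff
        proof (intro ballI impI)
          fix u w assume u: "u \<in> D \<inter> D2" "w \<in> V" "E u w"
          then show "w \<in> D \<inter> D2 \<union> {d, c2}" using ND[of u w] N2[of u w] aD bD by auto
        qed
        moreover have "D \<inter> D2 \<subset> D" using d D2V by auto
        ultimately show False using min[of "D \<inter> D2" d c2] False by auto
      qed
    qed
  qed
qed (use biconnD[OF G] D d in auto)

text \<open>A smallest side within \<open>D0\<close> is a single vertex, which is replaced by an
  edge, or contains a vertex that can simply be deleted; \<open>F\<close> covers both cases.
  Replacing the whole side could cost \<open>a\<close> and \<open>b\<close> many neighbours, whereas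
  one vertex costs any other vertex at most one.\<close>

lemma shrink_cut:
  assumes G: "biconn V E x y" and D0: "D0 \<noteq> {}" "D0 \<subseteq> V - {x, y}" "nbh V E D0 \<subseteq> {a0, b0}"
    and ne: "V - D0 - {x, y} \<noteq> {}"
  obtains d F where "d \<in> D0" "biconn (V - {d}) F x y" "\<And>u v. E u v \<Longrightarrow> F u v"
    "\<And>m. haspath (V - {d}) F x y m \<Longrightarrow> haspath V E x y m"
proof -
  define Q where "Q D \<longleftrightarrow> D \<noteq> {} \<and> D \<subseteq> D0 \<and> (\<exists>a b. nbh V E D \<subseteq> {a, b})" for D
  have "Q D0" using D0 unfolding Q_def by blast
  then obtain D where D: "Q D" "\<And>D'. Q D' \<Longrightarrow> card D \<le> card D'" using ex_has_least_nat[of Q D0 card] by blast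
  then obtain a b where N: "D \<noteq> {}" "D \<subseteq> D0" "nbh V E D \<subseteq> {a, b}" unfolding Q_def by blast
  have DV: "D \<subseteq> V - {x, y}" using N D0 by auto
  have fD: "finite D" using DV biconnD(1)[OF G] finite_subset by blast
  note cp = cut_pair[OF G N(1) DV N(3)]
  obtain d where d: "d \<in> D" using N by blast
  show ?thesis
  proof (cases "D = {d}")
    case True
    have B: "biconn (V - {d}) (add_edge E a b) x y"
      using cut_outer[OF G N(1) DV _ _ _ _ _ N(3)] cp ne N(2) True by auto
    show ?thesis
    proof (rule that[OF _ B])
      show "d \<in> D0" using d N by auto
      show "haspath (V - {d}) (add_edge E a b) x y m \<Longrightarrow> haspath V E x y m" for m
        using lift_haspath[OF G N(1) DV N(3)] True by simp
    qed (simp add: add_edge_def)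
  next
    case False
    have min: "\<not> nbh V E D' \<subseteq> {a', b'}" if D': "D' \<noteq> {}" "D' \<subset> D" for D' a' b'
    proof
      assume "nbh V E D' \<subseteq> {a', b'}"
      then have "Q D'" using D' N(2) unfolding Q_def by blast
      then show False using D(2)[of D'] psubset_card_mono[OF fD D'(2)] by simp
    qed
    have B: "biconn (V - {d}) E x y"
      by (rule biconn_delete_from_minimal_cut[OF G DV N(3) min d False])
    show ?thesis
    proof (rule that[OF _ B])
      show "d \<in> D0" using d N by auto
      show "haspath (V - {d}) E x y m \<Longrightarrow> haspath V E x y m" for m
        by (erule haspath_subset) auto
    qed
  qed
qed

lemma upath_length_ge:
  assumes "upath V E a p b" "a \<noteq> b"
  shows "2 \<le> length p" "\<not> E a b \<Longrightarrow> 3 \<le> length p"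
proof -
  obtain c p' where p: "p = a # c # p'" using assms unfolding upath_def by (cases p; cases "tl p") auto
  then show "2 \<le> length p" by simp
  assume "\<not> E a b"
  then show "3 \<le> length p" using assms p unfolding upath_def by (cases p') auto
qed

context path_bounds_below
begin

text \<open>
  Removing a light vertex lowers the deficit \<open>t + s\<close> by one. With \<open>s = 1\<close> one also gains that unit of
  the bound: no vertex of \<open>L\<close> may suffer from the removal, and a cut \<open>{z, c}\<close> at a light vertex \<open>z\<close>
  is entered through at least two edges because light vertices are not adjacent to the terminals.
\<close>

lemma light_deletion:
  assumes G: "biconn V E x y" and H: "heavy V E x y k L" and L: "L \<noteq> {}"
    and card: "card V = 2 * card L + t + s + 1" "1 \<le> t + s" "s \<le> 1"
    and far: "\<And>u. s = 1 \<Longrightarrow> u \<in> V - {x, y} - L \<Longrightarrow> \<not> E u x \<and> \<not> E u y"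
    and degs: "\<And>u v. u \<in> V - {x, y} - L \<Longrightarrow> v \<in> L \<Longrightarrow> k + s - 1 \<le> deg (V - {u}) E v"
    and z: "z \<in> V - {x, y} - L"
  shows "haspath V E x y (k - t)"
proof -
  note GD = biconnD[OF G] and sy = sympD[OF biconnD(2)[OF G]]
  have LV: "L \<subseteq> V - {x, y}" using H unfolding heavy_def by auto
  have del: "haspath (V - {u}) F x y (k - t)"
    if u: "u \<in> V - {x, y} - L" and B: "biconn (V - {u}) F x y" and F: "\<And>u v. E u v \<Longrightarrow> F u v" for u F
  proof -
    have "k + s - 1 \<le> deg (V - {u}) F v" if "v \<in> L" for v
      using degs[OF u that] deg_mono[of "V - {u}" "V - {u}" E v F] GD(1) F by fastforce
    then have "heavy (V - {u}) F x y (k + s - 1) L" using LV u unfolding heavy_def by auto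
    moreover have c: "card (V - {u}) = card V - 1" using u GD(1) by auto
    ultimately have "haspath (V - {u}) F x y (k + s - 1 - (card (V - {u}) - 1 - 2 * card L))"
      using card by (intro weak[OF _ B _ L]) auto
    then show ?thesis by (rule haspath_mono) (use c card in linarith)
  qed
  have ne: "V - {x, y, z} \<noteq> {}" using L LV z by auto
  consider "biconn (V - {z}) E x y" | D c where "D \<noteq> {}" "D \<subseteq> V - {x, y}" "z \<notin> D" "nbh V E D \<subseteq> {z, c}"
    using delete_or_cut[OF G ne] z by blast
  then show ?thesis
  proof cases
    case 1
    show ?thesis by (rule haspath_subset[OF del[OF z 1]]) auto
  next
    case 2
    note cp = cut_pair[OF G 2(1,2,4)] and cc = card_cut[OF G H 2(1,2,4)]
    show ?thesis
    proof (cases "L \<inter> D = {}")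
      case True
      \<comment> \<open>Although \<open>z\<close> resists deletion, the cut that shows this has a
        side of light vertices, and one of these can be removed instead.\<close>
      have "V - D - {x, y} \<noteq> {}" using True L LV by auto
      then obtain d F where d: "d \<in> D" "biconn (V - {d}) F x y" "\<And>u v. E u v \<Longrightarrow> F u v"
        "\<And>m. haspath (V - {d}) F x y m \<Longrightarrow> haspath V E x y m"
        using shrink_cut[OF G 2(1,2,4)] by blast
      have "d \<in> V - {x, y} - L" using d(1) 2(2) True by auto
      from d(4)[OF del[OF this d(2,3)]] show ?thesis .
    next
      case LD: False
      obtain c0 d0 p q where pq: "{c0, d0} = {z, c}" "upath (V - D) E x p c0" "upath (V - D) E d0 q y" "set p \<inter> set q = {}"
        by (rule linking_paths[OF G 2(1,2,4)])
      define e where "e = (length p - 1) + (length q - 1)"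
      have zL: "z \<notin> L" "z \<noteq> x" "z \<noteq> y" using z by auto
      have lam: "card (L \<inter> {z, c}) \<le> 1" "c \<notin> L \<Longrightarrow> card (L \<inter> {z, c}) = 0"
      proof -
        have "L \<inter> {z, c} \<subseteq> {c}" using zL by auto
        then show "card (L \<inter> {z, c}) \<le> 1" using card_mono[of "{c}" "L \<inter> {z, c}"] by simp
        show "card (L \<inter> {z, c}) = 0" if "c \<notin> L" using that zL by simp
      qed
      have cL: "c \<noteq> x \<and> c \<noteq> y" if "c \<in> L" using that LV by auto
      \<comment> \<open>The leg ending at \<open>z\<close> has at least \<open>1 + s\<close> edges.
        The leg at \<open>c\<close> may be empty, but has an edge if \<open>c \<in> L\<close>, as
        \<open>c\<close> is then no terminal; this pays for part of the cost of striking
        \<open>c\<close>.\<close>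
      have e: "1 + s + card (L \<inter> {z, c}) \<le> e"
      proof (cases "c0 = z")
        case True
        then have d0: "d0 = c" using pq(1) by (auto simp: doubleton_eq_iff)
        have "2 + s \<le> length p"
          using upath_length_ge[OF pq(2)] True zL far[OF _ z] sy[of x z] card(3) by (cases "s = 1") auto
        moreover have "1 + card (L \<inter> {z, c}) \<le> length q"
        proof (cases "c \<in> L")
          case True
          then show ?thesis using upath_length_ge(1)[OF pq(3)] d0 cL lam by auto
        next
          case False
          then show ?thesis using pq(3) lam unfolding upath_def by (cases q) auto
        qed
        ultimately show ?thesis unfolding e_def by linarith
      next
        case False
        then have d0: "d0 = z" "c0 = c" using pq(1) by (auto simp: doubleton_eq_iff)
        have "2 + s \<le> length q"
          using upath_length_ge[OF pq(3)] d0 zL far[OF _ z] card(3) by (cases "s = 1") auto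
        moreover have "1 + card (L \<inter> {z, c}) \<le> length p"
        proof (cases "c \<in> L")
          case True
          then show ?thesis using upath_length_ge(1)[OF pq(2)] d0 cL lam by auto
        next
          case False
          then show ?thesis using pq(2) lam unfolding upath_def by (cases p) auto
        qed
        ultimately show ?thesis unfolding e_def by linarith
      qed
      show ?thesis
      proof (cases "card D + 1 - 2 * card (L \<inter> D) \<le> t + e")
        case True
        have "card (D \<union> {z, c}) < card V"
          by (rule card_cut_inner[OF G 2(2)]) (use cp zL in auto)
        then have "card (D \<union> {c0, d0}) < card V" using pq(1) by simp
        moreover have "nbh V E D \<subseteq> {c0, d0}" using 2(4) pq(1) by simp
        ultimately have "haspath (D \<union> {c0, d0}) E c0 d0 (k - (card D + 1 - 2 * card (L \<inter> D)))"
          using weak_inner[OF G H 2(1,2) _ _ LD] by blast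
        from haspath_via[OF pq(2,3,4) _ this] 2(2)
        have "haspath V E x y (k - (card D + 1 - 2 * card (L \<inter> D)) + (length p - 1) + (length q - 1))" by blast
        then show ?thesis by (rule haspath_mono) (use True in \<open>unfold e_def, linarith\<close>)
      next
        case False
        then have big: "2 * card (L \<inter> D) + t + e \<le> card D" by linarith
        have "L - D - {z, c} \<noteq> {}"
        proof
          assume "L - D - {z, c} = {}"
          then have 0: "card (L - D - {z, c}) = 0" by (simp only: card.empty)
          have "3 + card (L \<inter> {z, c}) \<le> card ({x, y} \<union> {z, c})"
          proof (cases "c \<in> L")
            case True
            then show ?thesis using cL zL GD(6) cp lam by auto
          next
            case False
            have "card {x, y, z} \<le> card ({x, y} \<union> {z, c})" by (intro card_mono) auto
            then show ?thesis using False lam zL GD(6) by auto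
          qed
          then show False using 0 big e cc(4,5) card(1) by linarith
        qed
        from weak_outer[OF G H 2(1,2,4) this] show ?thesis
          by (rule haspath_mono) (use big e cc(5) card(1) lam(1) in linarith)
      qed
    qed
  qed
qed

end

section \<open>The induction step of the weak bound\<close>

lemma deg_Diff_nonadjacent: "\<not> E v x \<Longrightarrow> deg (V - {x}) E v = deg V E v"
  unfolding deg_def by (rule arg_cong[of _ _ card]) auto

lemma path_bounds_below_mono:
  fixes V W :: "'a set"
  assumes "path_bounds_below V" "card W \<le> card V"
  shows "path_bounds_below W"
proof -
  interpret path_bounds_below V by fact
  show ?thesis
  proof
    fix U :: "'a set" and E x y k L
    assume U: "card U < card W" "biconn U E x y" "heavy U E x y k L" "L \<noteq> {}"
    show "haspath U E x y (k - (card U - 1 - 2 * card L))"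
      by (rule weak[OF less_le_trans[OF U(1) assms(2)] U(2-4)])
  next
    fix U :: "'a set" and E x y k L z
    assume U: "card U < card W" "biconn U E x y" "heavy U E x y k L" "L \<noteq> {}"
      "z \<in> U - {x, y} - L" "E x z"
    show "haspath U E x y (k - (card U - 2 - 2 * card L))"
      by (rule strong[OF less_le_trans[OF U(1) assms(2)] U(2-6)])
  qed
qed

lemma unsplit_commute: "unsplit V E x y \<longleftrightarrow> unsplit V E y x"
  unfolding unsplit_def by (simp add: insert_commute)

context path_bounds_below
begin

text \<open>Because of \<open>k < card V\<close> the bound is at most two here.\<close>

lemma weak_single:
  assumes G: "biconn V E x y" and H: "heavy V E x y k L" and L: "card L = 1"
  shows "haspath V E x y (k - (card V - 1 - 2 * card L))"
proof -
  have "L \<noteq> {}" using L by auto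
  then have "k < card V" by (rule heavy_less_card[OF G H])
  then show ?thesis using haspath_mono[OF haspath_2[OF G]] L by simp
qed

text \<open>The sizes of the two sides add up to \<open>card V - 2\<close>. If a side with heavy
  vertices has a larger deficit than the whole graph, the other side has so many heavy vertices that
  its own deficit vanishes; if a side has none, the other side has all of them.\<close>

lemma weak_split:
  assumes G: "biconn V E x y" and H: "heavy V E x y k L" and L: "L \<noteq> {}"
    and s: "\<not> unsplit V E x y"
  shows "haspath V E x y (k - (card V - 1 - 2 * card L))"
proof -
  have fL: "finite L" by (rule heavy_finite[OF G H])
  obtain D where D: "D \<noteq> {}" "D \<subset> V - {x, y}" "nbh V E D \<subseteq> {x, y}"
    using s unfolding unsplit_def by blast
  have via: "haspath V E x y (k - (card V - 1 - 2 * card L))"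
    if D': "D' \<noteq> {}" "D' \<subseteq> V - {x, y}" "nbh V E D' \<subseteq> {x, y}" "card D' + 2 < card V" "L \<inter> D' \<noteq> {}"
      "card D' + 1 - 2 * card (L \<inter> D') \<le> card V - 1 - 2 * card L" for D'
  proof -
    have "card (D' \<union> {x, y}) < card V" using card_cut(1)[OF G H D'(1-3)] D'(4) by simp
    from haspath_inner[OF weak_inner[OF G H D'(1-3) this D'(5)] G]
    have "haspath V E x y (k - (card D' + 1 - 2 * card (L \<inter> D')))" using D'(2) by auto
    then show ?thesis by (rule haspath_mono) (use D'(6) in linarith)
  qed
  define R where "R = V - {x, y} - D"
  note sc = split_complement[OF G D(2,3), folded R_def]
  have DV: "D \<subseteq> V - {x, y}" using D by auto
  have cl: "card L = card (L \<inter> D) + card (L \<inter> R)"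
    unfolding R_def by (rule card_heavy_split[OF H fL DV])
  have pos: "0 < card D" "0 < card R"
    using card_cut(3)[OF G H D(1) DV D(3)] card_cut(3)[OF G H sc(2,3,1)] by auto
  have l0: "card L \<noteq> 0" using L fL by simp
  have iff: "L \<inter> D \<noteq> {} \<longleftrightarrow> card (L \<inter> D) \<noteq> 0" "L \<inter> R \<noteq> {} \<longleftrightarrow> card (L \<inter> R) \<noteq> 0"
    using fL by auto
  show ?thesis
  proof (cases "card (L \<inter> D) \<noteq> 0 \<and> card D + 1 - 2 * card (L \<inter> D) \<le> card V - 1 - 2 * card L")
    case True
    then show ?thesis using via[OF D(1) DV D(3) sc(4)] iff by blast
  next
    case False
    have "card (L \<inter> R) \<noteq> 0 \<and> card R + 1 - 2 * card (L \<inter> R) \<le> card V - 1 - 2 * card L"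
      using False cl sc(5) l0 pos by (cases "card (L \<inter> D) = 0") auto
    moreover have "card R + 2 < card V" using sc(5) pos by linarith
    ultimately show ?thesis using via[OF sc(2,3,1)] iff by blast
  qed
qed

text \<open>Unlike in \<open>strong_cut\<close>, no exception remains. If routing through
  \<open>D\<close> fails, then \<open>card D\<close> exceeds \<open>2 * card (L \<inter> D)\<close>;
  this pays one of the two units for striking \<open>c\<close>, and \<open>c\<close> as a light
  neighbour of \<open>x\<close> pays the other.\<close>

lemma weak_cut:
  assumes G: "biconn V E x y" and H: "heavy V E x y k L" and L: "1 < card L"
    and D: "D \<noteq> {}" "D \<subseteq> V - {x, y}" and N: "nbh V E D \<subseteq> {x, c}" and c: "c \<noteq> y"
  shows "haspath V E x y (k - (card V - 1 - 2 * card L))"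
proof -
  note GD = biconnD[OF G] and cp = cut_pair[OF G D N] and cc = card_cut[OF G H D N]
  have xL: "x \<notin> L" "y \<notin> L" using H unfolding heavy_def by auto
  have "L \<inter> {x, c} \<subseteq> {c}" using xL by auto
  then have lc: "card (L \<inter> {x, c}) \<le> 1" using card_mono[of "{c}" "L \<inter> {x, c}"] by simp
  have "card ({x, y} \<union> {x, c}) = 3" using cp c GD(6) by (simp add: insert_commute)
  then have n: "card D + 3 \<le> card V" using cc(4) by linarith
  have lt: "card (D \<union> {x, c}) < card V" using cc(1) n by simp
  show ?thesis
  proof (cases "L \<inter> D \<noteq> {} \<and> card D \<le> 2 * card (L \<inter> D) + (card V - 1 - 2 * card L)")
    case True
    then have "haspath V E x y (Suc (k - (card D + 1 - 2 * card (L \<inter> D))))"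
      by (intro haspath_via_terminal_cut_Suc[OF G D N c weak_inner[OF G H D N lt]]) auto
    then show ?thesis by (rule haspath_mono) (use True in linarith)
  next
    case False
    have big: "2 * card (L \<inter> D) + 1 \<le> card D" "card (L \<inter> D) = 0 \<or> 2 * card (L \<inter> D) + (card V - 1 - 2 * card L) < card D"
      using False cc(3) by (cases "L \<inter> D = {}"; simp)+
    have "L - D - {x, c} \<noteq> {}"
    proof
      assume "L - D - {x, c} = {}"
      then have "card (L - D - {x, c}) = 0" by (simp only: card.empty)
      then show False using big cc(5) lc n L by linarith
    qed
    from strong_outer[OF G H D N c this] show ?thesis
      by (rule haspath_mono) (use big cc(5) lc in linarith)
  qed
qed

text \<open>In a counterexample no cut contains a terminal, so every inner neighbour of
  \<open>x\<close> may become the start. A surplus of heavy vertices absorbs the loss of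
  \<open>x'\<close>, and a shortage allows the deletion of a light vertex. In perfect balance the
  neighbours of \<open>x\<close> must be heavy and have no light neighbours themselves, and this
  lets a light vertex be deleted after the step without further loss of degree.\<close>

lemma weak_step:
  assumes G: "biconn V E x y" and H: "heavy V E x y k L" and L: "L \<noteq> {}"
  shows "haspath V E x y (k - (card V - 1 - 2 * card L))"
proof (rule ccontr)
  assume neg: "\<not> ?thesis"
  note GD = biconnD[OF G] and sy = sympD[OF biconnD(2)[OF G]]
  have G': "biconn V E y x" and H': "heavy V E y x k L" using G H biconn_commute heavy_commute by metis+
  have fL: "finite L" by (rule heavy_finite[OF G H])
  have LV: "L \<subseteq> V - {x, y}" using H unfolding heavy_def by auto
  have "card L \<noteq> 0" using L fL by simp
  moreover have "card L \<noteq> 1" using neg weak_single[OF G H] by blast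
  ultimately have L1: "1 < card L" by linarith
  have ns: "unsplit V E x y" using neg weak_split[OF G H L] by blast
  have ns': "unsplit V E y x" using ns unsplit_commute by metis
  have step: "biconn (V - {u}) E u' v"
    if u: "biconn V E u v" "unsplit V E u v" "u' \<in> V - {u, v}" "V - {u, u', v} \<noteq> {}"
      and cut: "\<And>D c. D \<noteq> {} \<Longrightarrow> D \<subseteq> V - {u, v} \<Longrightarrow> nbh V E D \<subseteq> {u, c} \<Longrightarrow> c \<noteq> v \<Longrightarrow> False" for u u' v
  proof (rule ccontr)
    assume "\<not> ?thesis"
    then obtain D c where D: "D \<noteq> {}" "D \<subseteq> V - {u, u', v}" "nbh V E D \<subseteq> {u, c}"
      using step_or_cut[OF u(1,3,4)] by blast
    have "D \<subset> V - {u, v}" using D(2) u(3) by auto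
    then have "c \<noteq> v" using unsplitD[OF u(2) D(1) _ D(3)] by simp
    then show False using cut[OF D(1) _ D(3)] D(2) by auto
  qed
  have cutx: False if "D \<noteq> {}" "D \<subseteq> V - {x, y}" "nbh V E D \<subseteq> {x, c}" "c \<noteq> y" for D c
    using weak_cut[OF G H L1 that] neg by blast
  have cuty: False if "D \<noteq> {}" "D \<subseteq> V - {y, x}" "nbh V E D \<subseteq> {y, c}" "c \<noteq> x" for D c
    using haspath_commute[OF GD(2) weak_cut[OF G' H' L1 that]] neg by blast
  have ne: "V - {x, u, y} \<noteq> {}" for u
  proof -
    have "card L \<le> card {u}" if "L \<subseteq> {u}" using that by (intro card_mono) auto
    then have "\<not> L \<subseteq> {u}" using L1 by auto
    then show ?thesis using LV by blast
  qed
  have ne': "V - {y, u, x} \<noteq> {}" for u using ne[of u] by (simp add: insert_commute)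
  note stepx = step[OF G ns _ ne cutx] and stepy = step[OF G' ns' _ ne' cuty]
  obtain x' where x': "x' \<in> V - {x, y}" "E x x'" by (rule biconn_neighbour[OF G])
  define W where "W = V - {x}"
  have BW: "biconn W E x' y" unfolding W_def by (rule stepx[OF x'(1)])
  have HW: "heavy W E x' y (k - 1) (L - {x'})" unfolding W_def by (rule heavy_remove[OF H GD(1)])
  have cW: "card W = card V - 1" "card W < card V"
    unfolding W_def using card_remove[OF GD(1,4)] biconn_card[OF G] by auto
  have LW: "L - {x'} \<noteq> {}"
  proof
    assume "L - {x'} = {}"
    then have "L \<subseteq> {x'}" by auto
    then have "card L \<le> card {x'}" by (intro card_mono) auto
    then show False using L1 by simp
  qed
  have cL: "card L \<le> card (L - {x'}) + 1" using diff_card_le_card_Diff[of "{x'}" L] by simp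
  have stepW: "haspath V E x y (k - m)" if "haspath W E x' y (k - 1 - m)" for m
    by (rule haspath_step[where x' = x']) (use that GD(4) x'(2) in \<open>simp_all add: W_def\<close>)
  consider "card V - 1 < 2 * card L" | "2 * card L < card V - 1" | "card V - 1 = 2 * card L" by linarith
  then show False
  proof cases
    case 1
    \<comment> \<open>As \<open>card V \<le> 2 * card L\<close>, the truncated deficit remains zero
      even if \<open>x'\<close> is struck from \<open>L\<close>.\<close>
    have "haspath W E x' y (k - 1 - (card W - 1 - 2 * card (L - {x'})))"
      by (rule weak[OF cW(2) BW HW LW])
    then have "haspath W E x' y (k - 1 - (card V - 1 - 2 * card L))"
      by (rule haspath_mono) (use 1 cW cL in linarith)
    then show False using stepW neg by blast
  next
    case 2
    define t where "t = card V - 1 - 2 * card L"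
    have "L \<noteq> V - {x, y}"
    proof
      assume "L = V - {x, y}"
      then have "card L = card V - 2" using GD by (simp add: card_Diff_subset)
      then show False using 2 L1 by linarith
    qed
    then obtain z where z: "z \<in> V - {x, y} - L" using LV by blast
    have "haspath V E x y (k - t)"
    proof (rule light_deletion[OF G H L _ _ _ _ _ z, where s = 0])
      show "card V = 2 * card L + t + 0 + 1" "1 \<le> t + 0" using 2 unfolding t_def by linarith+
      fix u v assume "v \<in> L"
      then have "k \<le> deg V E v" using H unfolding heavy_def by auto
      then show "k + 0 - 1 \<le> deg (V - {u}) E v" using deg_Diff_le[OF GD(1), of E v u] by linarith
    qed auto
    then show False using neg unfolding t_def by blast
  next
    case 3
    have lx: "E x z \<Longrightarrow> False" if z: "z \<in> V - {x, y} - L" for z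
    proof -
      assume "E x z"
      from strong_start[OF G H L z this stepx] z have "haspath V E x y (k - (card V - 2 - 2 * card L))" by auto
      then show False using 3 neg by simp
    qed
    have ly: "E y z \<Longrightarrow> False" if z: "z \<in> V - {x, y} - L" for z
    proof -
      assume yz: "E y z"
      have z': "z \<in> V - {y, x} - L" using z by auto
      from strong_start[OF G' H' L z' yz stepy] z have "haspath V E y x (k - (card V - 2 - 2 * card L))" by auto
      then show False using 3 neg haspath_commute[OF GD(2)] by fastforce
    qed
    have x'L: "x' \<in> L" using lx x' by blast
    have cLx: "card (L - {x'}) = card L - 1" using x'L fL by simp
    \<comment> \<open>Otherwise \<open>u\<close> is a light neighbour of the new start
      \<open>v\<close>, and the strong bound regains the unit lost by striking \<open>v\<close> from
      \<open>L\<close>.\<close>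
    have near: "\<not> E v u" if u: "u \<in> V - {x, y} - L" and v: "v \<in> V - {x, y}" "E x v" for u v
    proof
      assume "E v u"
      have vL: "v \<in> L" using lx v by blast
      have Bv: "biconn (V - {x}) E v y" by (rule stepx[OF v(1)])
      have Hv: "heavy (V - {x}) E v y (k - 1) (L - {v})" by (rule heavy_remove[OF H GD(1)])
      have cv: "card (L - {v}) = card L - 1" using vL fL by simp
      have Lv: "L - {v} \<noteq> {}"
      proof
        assume "L - {v} = {}"
        then have "card (L - {v}) = 0" by (simp only: card.empty)
        then show False using cv L1 by simp
      qed
      have "haspath (V - {x}) E v y (k - 1 - (card (V - {x}) - 2 - 2 * card (L - {v})))"
        by (rule strong[OF _ Bv Hv Lv, of u]) (use cW u vL \<open>E v u\<close> in \<open>auto simp: W_def\<close>)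
      then have "haspath (V - {x}) E v y (k - 1 - 0)"
        by (rule haspath_mono) (use cv cW 3 L1 in \<open>auto simp: W_def\<close>)
      then have "haspath V E x y (k - 0)" using GD(4) v(2) by (rule haspath_step)
      then show False using neg 3 by simp
    qed
    have "L \<noteq> V - {x, y}"
    proof
      assume "L = V - {x, y}"
      then have "card L = card V - 2" using GD by (simp add: card_Diff_subset)
      then show False using 3 L1 by linarith
    qed
    then obtain z where z: "z \<in> V - {x, y} - L" using LV by blast
    interpret W: path_bounds_below W
      by (rule path_bounds_below_mono[OF path_bounds_below_axioms]) (use cW in simp)
    have "haspath W E x' y (k - 1 - 0)"
    proof (rule W.light_deletion[OF BW HW LW, where s = 1])
      show "card W = 2 * card (L - {x'}) + 0 + 1 + 1" using 3 cW cLx L1 by linarith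
      show "z \<in> W - {x', y} - (L - {x'})" using z x'L unfolding W_def by auto
    next
      fix u assume "u \<in> W - {x', y} - (L - {x'})"
      then have u: "u \<in> V - {x, y} - L" unfolding W_def by auto
      show "\<not> E u x' \<and> \<not> E u y" using near[OF u x'] ly[OF u] sy by blast
    next
      fix u v assume "u \<in> W - {x', y} - (L - {x'})" and v: "v \<in> L - {x'}"
      then have u: "u \<in> V - {x, y} - L" unfolding W_def by auto
      have kv: "k \<le> deg V E v" using H v unfolding heavy_def by auto
      \<comment> \<open>By \<open>near\<close>, the vertex \<open>v\<close> is not adjacent to both
        \<open>x\<close> and \<open>u\<close>, so deleting the two costs it at most one
        neighbour.\<close>
      have "deg V E v \<le> Suc (deg (V - {x} - {u}) E v)"
      proof (cases "E v x")
        case True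
        then have "\<not> E v u" using near[OF u, of v] v LV sy by blast
        then show ?thesis using deg_Diff_le[OF GD(1), of E v x] deg_Diff_nonadjacent[of E v u "V - {x}"] by simp
      next
        case False
        then show ?thesis using deg_Diff_le[of "V - {x}" E v u] deg_Diff_nonadjacent[of E v x V] GD(1) by simp
      qed
      then show "k - 1 + 1 - 1 \<le> deg (W - {u}) E v" using kv unfolding W_def by linarith
    qed auto
    from stepW[OF this] show False using neg 3 by simp
  qed
qed

end

lemma path_bounds: "path_bounds_below V"
proof (induction "card V" arbitrary: V rule: less_induct)
  case less
  show ?case
  proof
    fix W :: "'a set" and E x y k L
    assume W: "card W < card V" "biconn W E x y" "heavy W E x y k L" "L \<noteq> {}"
    show "haspath W E x y (k - (card W - 1 - 2 * card L))"
      by (rule path_bounds_below.weak_step[OF less[OF W(1)] W(2-4)])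
  next
    fix W :: "'a set" and E x y k L z
    assume W: "card W < card V" "biconn W E x y" "heavy W E x y k L" "L \<noteq> {}"
      "z \<in> W - {x, y} - L" "E x z"
    show "haspath W E x y (k - (card W - 2 - 2 * card L))"
      by (rule path_bounds_below.strong_step[OF less[OF W(1)] W(2-6)])
  qed
qed

theorem long_path_between_terminals:
  assumes "biconn V E x y" "heavy V E x y k L" "card V \<le> 2 * card L + 1"
  shows "haspath V E x y k"
proof -
  have "L \<noteq> {}" using biconn_card[OF assms(1)] assms(3) by auto
  from path_bounds_below.weak_step[OF path_bounds assms(1,2) this] show ?thesis using assms(3) by simp
qed

section \<open>From paths to fans\<close>

text \<open>The terminals represent two groups of edges to the cycle. \<open>X\<close> and
  \<open>Y\<close> may overlap, so a vertex can retain two of its edges to the cycle.\<close>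

definition join_terminals :: "'a set \<Rightarrow> ('a \<Rightarrow> 'a \<Rightarrow> bool) \<Rightarrow> 'a \<Rightarrow> 'a \<Rightarrow> 'a set \<Rightarrow> 'a set \<Rightarrow> 'a \<Rightarrow> 'a \<Rightarrow> bool" where
  "join_terminals H E x y X Y u w \<longleftrightarrow> u \<in> H \<and> w \<in> H \<and> E u w \<or>
     u = x \<and> w \<in> X \<or> w = x \<and> u \<in> X \<or> u = y \<and> w \<in> Y \<or> w = y \<and> u \<in> Y"

text \<open>A proper subset of \<open>H\<close> has a neighbour within \<open>H\<close>, so if that
  is its only one, no terminal is adjacent to it; by \<open>cover\<close> it then has no neighbour
  in \<open>S\<close> either, against \<open>two\<close>. For \<open>H\<close> itself both terminals
  are neighbours.\<close>

lemma biconn_join_terminals: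
  assumes fin: "finite H" and E: "symp E" "irreflp E" and xy: "x \<noteq> y" "x \<notin> H" "y \<notin> H"
    and XY: "X \<noteq> {}" "Y \<noteq> {}" "X \<subseteq> H" "Y \<subseteq> H" and cover: "\<And>u s. u \<in> H \<Longrightarrow> s \<in> S \<Longrightarrow> E u s \<Longrightarrow> u \<in> X \<union> Y"
    and conn: "\<And>D. D \<noteq> {} \<Longrightarrow> D \<subseteq> H \<Longrightarrow> nbh H E D = {} \<Longrightarrow> D = H"
    and two: "\<And>D c. D \<noteq> {} \<Longrightarrow> D \<subseteq> H \<Longrightarrow> \<not> nbh (H \<union> S) E D \<subseteq> {c}"
  shows "biconn (H \<union> {x, y}) (join_terminals H E x y X Y) x y"
proof (rule biconnI)
  let ?F = "join_terminals H E x y X Y"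
  show "symp ?F" using E(1) unfolding symp_def join_terminals_def by blast
  show "irreflp ?F" using E(2) xy XY unfolding irreflp_def join_terminals_def by blast
  show "H \<union> {x, y} - {x, y} \<noteq> {}" using XY xy by blast
  fix D c assume D: "D \<noteq> {}" "D \<subseteq> H \<union> {x, y} - {x, y}" "nbh (H \<union> {x, y}) ?F D \<subseteq> {c}"
  have DH: "D \<subseteq> H" using D by auto
  have N: "w \<in> D \<or> w = c" if "u \<in> D" "w \<in> H \<union> {x, y}" "?F u w" for u w
    using D(3) that unfolding nbh_subset_iff by auto
  show False
  proof (cases "D = H")
    case True
    obtain u v where "u \<in> X" "v \<in> Y" using XY by blast
    then have "x = c" "y = c" using N[of u x] N[of v y] XY xy True unfolding join_terminals_def by auto
    then show False using xy by simp
  next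
    case False
    then have "nbh H E D \<noteq> {}" using conn[OF D(1) DH] by blast
    then obtain w d where w: "w \<in> H" "w \<notin> D" "d \<in> D" "E d w" unfolding nbh_def by auto
    then have c: "c = w" using N[of d w] DH unfolding join_terminals_def by auto
    have "nbh (H \<union> S) E D \<subseteq> {c}" unfolding nbh_subset_iff
    proof (intro ballI impI)
      fix u v assume u: "u \<in> D" "v \<in> H \<union> S" "E u v"
      show "v \<in> D \<union> {c}"
      proof (cases "v \<in> H")
        case True
        then show ?thesis using N[of u v] u DH unfolding join_terminals_def by auto
      next
        case False
        then have "u \<in> X \<union> Y" using cover[of u v] u DH by auto
        then have "x = c \<or> y = c" using N[of u x] N[of u y] u(1) xy DH unfolding join_terminals_def by auto
        then show ?thesis using c w xy by auto
      qed
    qed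
    then show False using two[OF D(1) DH] by blast
  qed
qed (use fin xy in auto)

lemma deg_join_terminals:
  assumes "finite H" "x \<noteq> y" "x \<notin> H" "y \<notin> H" "u \<in> H"
  shows "deg (H \<union> {x, y}) (join_terminals H E x y X Y) u =
    deg H E u + (if u \<in> X then 1 else 0) + (if u \<in> Y then 1 else 0)"
proof -
  have "{w \<in> H \<union> {x, y}. join_terminals H E x y X Y u w} =
    {w \<in> H. E u w} \<union> ((if u \<in> X then {x} else {}) \<union> (if u \<in> Y then {y} else {}))"
    using assms unfolding join_terminals_def by auto
  then have "deg (H \<union> {x, y}) (join_terminals H E x y X Y) u =
    card ({w \<in> H. E u w} \<union> ((if u \<in> X then {x} else {}) \<union> (if u \<in> Y then {y} else {})))"
    unfolding deg_def by simp
  also have "\<dots> = card {w \<in> H. E u w} + card ((if u \<in> X then {x} else {}) \<union> (if u \<in> Y then {y} else {}))"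
    using assms by (intro card_Un_disjoint) auto
  also have "card ((if u \<in> X then {x} else {}) \<union> (if u \<in> Y then {y} else {})) =
    (if u \<in> X then 1 else 0) + (if u \<in> Y then 1 else 0)" using assms(2) by simp
  finally show ?thesis unfolding deg_def by simp
qed

lemma haspath_join_terminals:
  assumes hp: "haspath (H \<union> {x, y}) (join_terminals H E x y X Y) x y m"
    and xy: "x \<noteq> y" "x \<notin> H" "y \<notin> H" and XY: "X \<subseteq> H" "Y \<subseteq> H"
  obtains q where "q \<noteq> []" "set q \<subseteq> H" "distinct q" "successively E q" "hd q \<in> X" "last q \<in> Y" "m < length q + 2"
proof -
  let ?F = "join_terminals H E x y X Y"
  obtain p where p: "upath (H \<union> {x, y}) ?F x p y" "m < length p" using hp unfolding haspath_def by blast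
  obtain p' where p': "p = x # p'" "p' \<noteq> []" using p xy unfolding upath_def by (cases p) (auto split: if_splits)
  then obtain q where q: "p = x # q @ [y]" using p(1) unfolding upath_def by (metis append_butlast_last_id last_ConsR)
  have s: "successively ?F (x # q @ [y])" "distinct (x # q @ [y])" "set q \<subseteq> H \<union> {x, y}"
    using p(1) unfolding q upath_def by auto
  have qH: "set q \<subseteq> H" using s by auto
  have "\<not> ?F x y" using xy XY unfolding join_terminals_def by auto
  then have q0: "q \<noteq> []" using s(1) by auto
  have F: "?F x (hd q)" "?F (last q) y" "successively ?F q"
    using s(1) q0 by (auto simp: successively_Cons successively_append_iff hd_append)
  have "hd q \<in> H" "last q \<in> H" using qH q0 by auto
  then have "hd q \<in> X" "last q \<in> Y" using F xy XY unfolding join_terminals_def by auto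
  moreover have "successively E q"
    by (rule successively_mono[OF F(3)]) (use qH xy in \<open>auto simp: join_terminals_def\<close>)
  ultimately show ?thesis using that[of q] q0 qH s(2) p(2) q by auto
qed

text \<open>
  Let \<open>d\<close> be the largest number of neighbours in \<open>S\<close> of a vertex of \<open>H\<close>. If \<open>d \<ge> 2\<close>, a terminal \<open>x\<close> is
  joined to the vertices attaining \<open>d\<close> and \<open>y\<close> to all vertices with a neighbour in \<open>S\<close>. This costs at
  most \<open>d - 2\<close> in each degree, and the loss is recovered at the first inner vertex of the path, which has
  \<open>d\<close> neighbours in \<open>S\<close>. If \<open>d \<le> 1\<close>, splitting \<open>S\<close> between \<open>x\<close> and \<open>y\<close> preserves all degrees.
\<close>

lemma long_spider:
  assumes fin: "finite H" "finite S" and HS: "H \<inter> S = {}" "H \<noteq> {}" and E: "symp E" "irreflp E"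
    and conn: "\<And>D. D \<noteq> {} \<Longrightarrow> D \<subseteq> H \<Longrightarrow> nbh H E D = {} \<Longrightarrow> D = H"
    and two: "\<And>D c. D \<noteq> {} \<Longrightarrow> D \<subseteq> H \<Longrightarrow> \<not> nbh (H \<union> S) E D \<subseteq> {c}"
    and many: "card H + 1 \<le> 2 * card {v \<in> H. k \<le> deg (H \<union> S) E v}"
  obtains q s T where "q \<noteq> []" "set q \<subseteq> H" "distinct q" "successively E q" "E (last q) s"
    "s \<in> S" "T \<subseteq> S - {s}" "T \<noteq> {}" "\<forall>t\<in>T. E (hd q) t" "k \<le> length q + card T"
proof -
  define L where "L = {v \<in> H. k \<le> deg (H \<union> S) E v}"
  define N where "N v = {s \<in> S. E v s}" for v
  have fN: "finite (N v)" for v unfolding N_def using fin by simp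
  have degs: "deg (H \<union> S) E v = deg H E v + card (N v)" for v
  proof -
    have "{w \<in> H \<union> S. E v w} = {w \<in> H. E v w} \<union> N v" unfolding N_def by auto
    then show ?thesis unfolding deg_def using fin HS fN[of v] by (subst card_Un_disjoint[symmetric]) (auto simp: N_def)
  qed
  have nH: "\<not> nbh (H \<union> S) E H \<subseteq> {c}" for c using two[of H c] HS by simp
  \<comment> \<open>The value \<open>undefined\<close> is arbitrary: any instance shows that
    \<open>H\<close> has some neighbour in \<open>S\<close>.\<close>
  obtain x where x: "x \<in> S" "\<exists>u\<in>H. E u x" using nH[of undefined] unfolding nbh_def by auto
  obtain y where y: "y \<in> S" "y \<noteq> x" "\<exists>u\<in>H. E u y" using nH[of x] unfolding nbh_def by auto
  have xy: "x \<noteq> y" "x \<notin> H" "y \<notin> H" using x y HS by auto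
  define V where "V = H \<union> {x, y}"
  have cV: "card V = card H + 2" unfolding V_def using fin xy by (subst card_Un_disjoint) auto
  have main: "haspath V (join_terminals H E x y X Y) x y k'"
    if XY: "X \<noteq> {}" "Y \<noteq> {}" "X \<subseteq> H" "Y \<subseteq> H" "\<And>u s. u \<in> H \<Longrightarrow> s \<in> S \<Longrightarrow> E u s \<Longrightarrow> u \<in> X \<union> Y"
      and dg: "\<And>u. u \<in> L \<Longrightarrow> k' \<le> deg H E u + (if u \<in> X then 1 else 0) + (if u \<in> Y then 1 else 0)" for X Y k'
  proof (rule long_path_between_terminals)
    show "biconn V (join_terminals H E x y X Y) x y" unfolding V_def
      by (rule biconn_join_terminals[OF fin(1) E xy XY conn two])
    show "heavy V (join_terminals H E x y X Y) x y k' L"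
      using dg deg_join_terminals[OF fin(1) xy] xy unfolding heavy_def V_def L_def by auto
    show "card V \<le> 2 * card L + 1" using many cV unfolding L_def by simp
  qed
  define d where "d = Max ((\<lambda>v. card (N v)) ` H)"
  have dmax: "card (N v) \<le> d" if "v \<in> H" for v unfolding d_def using that fin by auto
  obtain v0 where v0: "v0 \<in> H" "card (N v0) = d"
  proof -
    have "d \<in> (\<lambda>v. card (N v)) ` H" unfolding d_def using fin HS by (intro Max_in) auto
    then show ?thesis using that by auto
  qed
  show ?thesis
  proof (cases "2 \<le> d")
    case True
    define X where "X = {v \<in> H. card (N v) = d}"
    define Y where "Y = {v \<in> H. N v \<noteq> {}}"
    have "N v0 \<noteq> {}" using v0 True by auto
    then have XY: "X \<noteq> {}" "Y \<noteq> {}" "X \<subseteq> H" "Y \<subseteq> H" "\<And>u s. u \<in> H \<Longrightarrow> s \<in> S \<Longrightarrow> E u s \<Longrightarrow> u \<in> X \<union> Y"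
      using v0 unfolding X_def Y_def by (auto simp: N_def)
    have dg: "k + 2 - d \<le> deg H E u + (if u \<in> X then 1 else 0) + (if u \<in> Y then 1 else 0)" if "u \<in> L" for u
    proof -
      have u: "u \<in> H" "k \<le> deg H E u + card (N u)" using that degs unfolding L_def by auto
      have "N u = {} \<longleftrightarrow> card (N u) = 0" using fN by simp
      then show ?thesis using u dmax[OF u(1)] True unfolding X_def Y_def by auto
    qed
    obtain q where q: "q \<noteq> []" "set q \<subseteq> H" "distinct q" "successively E q" "hd q \<in> X" "last q \<in> Y" "k + 2 - d < length q + 2"
      by (rule haspath_join_terminals[OF main[OF XY dg, unfolded V_def] xy XY(3,4)])
    obtain s where s: "s \<in> S" "E (last q) s" using q(6) unfolding Y_def N_def by auto
    \<comment> \<open>The end \<open>s\<close> of the long leg may be one of the \<open>d\<close>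
      neighbours of its first vertex.\<close>
    have cT: "d - 1 \<le> card (N (hd q) - {s})" using q(5) diff_card_le_card_Diff[of "{s}" "N (hd q)"] unfolding X_def by simp
    show ?thesis
    proof (rule that[OF q(1-4) s(2,1)])
      show "N (hd q) - {s} \<noteq> {}"
      proof
        assume "N (hd q) - {s} = {}"
        then have "card (N (hd q) - {s}) = 0" by (simp only: card.empty)
        then show False using cT True by simp
      qed
      show "k \<le> length q + card (N (hd q) - {s})" using cT q(7) True by linarith
    qed (auto simp: N_def)
  next
    case False
    define X where "X = {u \<in> H. E u x}"
    define Y where "Y = {u \<in> H. \<exists>s\<in>S - {x}. E u s}"
    have XY: "X \<noteq> {}" "Y \<noteq> {}" "X \<subseteq> H" "Y \<subseteq> H" "\<And>u s. u \<in> H \<Longrightarrow> s \<in> S \<Longrightarrow> E u s \<Longrightarrow> u \<in> X \<union> Y"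
      using x y unfolding X_def Y_def by auto
    have dg: "k \<le> deg H E u + (if u \<in> X then 1 else 0) + (if u \<in> Y then 1 else 0)" if "u \<in> L" for u
    proof -
      have u: "u \<in> H" "k \<le> deg H E u + card (N u)" using that degs unfolding L_def by auto
      have "card (N u) = 0 \<or> N u \<noteq> {}" by auto
      moreover have "u \<in> X \<or> u \<in> Y" if "N u \<noteq> {}" using that u(1) XY(5) unfolding N_def by auto
      ultimately show ?thesis using u dmax[OF u(1)] False by auto
    qed
    obtain q where q: "q \<noteq> []" "set q \<subseteq> H" "distinct q" "successively E q" "hd q \<in> X" "last q \<in> Y" "k < length q + 2"
      by (rule haspath_join_terminals[OF main[OF XY dg, unfolded V_def] xy XY(3,4)])
    obtain s where s: "s \<in> S" "E (last q) s" "s \<noteq> x" using q(6) unfolding Y_def by auto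
    show ?thesis
      by (rule that[OF q(1-4) s(2,1), of "{x}"]) (use x s q in \<open>auto simp: X_def\<close>)
  qed
qed

section \<open>Components and separators of symmetric digraphs\<close>

lemma strongly_connected_imp_connected:
  assumes "strongly_connected G"
  shows "connected G"
proof -
  have "arcs_ends G \<subseteq> symcl (arcs_ends G)" by (auto simp: symcl_def)
  note mono = rtrancl_on_mono[OF this subset_refl]
  show ?thesis
    unfolding connected_conv
    by (intro conjI ballI mono) (use assms in \<open>auto simp: strongly_connected_def reachable_def\<close>)
qed

lemma arc_mono_connected: "arc_mono connected"
  unfolding arc_mono_def
  by (metis spanning_def subgraphE wf_digraph.connected_spanning_imp_connected)

lemma (in sym_digraph) induced_connected_imp_strongly_connected:
  assumes "induced_subgraph H G" "connected H"
  shows "strongly_connected H"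
  using assms induced_graph_imp_symmetric[OF sym_arcs assms(1)] wf_digraphI_induced
    wf_digraph.symmetric_connected_imp_strongly_connected by blast

text \<open>A maximal connected subgraph is induced, hence symmetric, hence strongly connected. This
  gives access to reachability along arcs.\<close>

lemma (in sym_digraph) components_eq_sccs: "components G = sccs"
proof (intro set_eqI iffI)
  fix H assume "H \<in> components G"
  then have m: "max_subgraph connected H" by (simp add: components_def)
  have "induced_subgraph H G" by (rule induced_subgraphI_arc_mono[OF m arc_mono_connected])
  then have "strongly_connected H"
    using induced_connected_imp_strongly_connected max_subgraph_prop[OF m] by blast
  then show "H \<in> sccs"
    unfolding sccs_altdef2 using max_subgraph_mp[OF m strongly_connected_imp_connected] by blast
next
  fix H assume "H \<in> sccs"
  then have m: "max_subgraph strongly_connected H" by (simp add: sccs_altdef2)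
  have sH: "subgraph H G" by (rule subgraphI_max_subgraph[OF m])
  have "max_subgraph connected H"
  proof (rule max_subgraphI)
    show "connected H" using max_subgraph_prop[OF m] strongly_connected_imp_connected by blast
    show "subgraph H G" by (rule sH)
    fix y assume y: "H \<noteq> y" "subgraph H y" "subgraph y G"
    show "\<not> connected y"
    proof
      assume cy: "connected y"
      \<comment> \<open>The connected subgraph \<open>y\<close> may contain an edge in one
        orientation only, so it need not be strongly connected. The induced subgraph on its vertices
        is, and maximality of \<open>H\<close> applies to that.\<close>
      let ?K = "G \<restriction> verts y"
      have vy: "verts y \<subseteq> verts G" using y(3) by auto
      have iK: "induced_subgraph ?K G" using induced_induce[OF vy] .
      have yK: "subgraph y ?K" by (rule subgraph_induce_subgraphI2[OF y(3)])
      have "connected ?K"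
        using wf_digraph.connected_spanning_imp_connected[OF wellformed_induce_subgraph, of y "verts y"] yK cy
        unfolding spanning_def by simp
      then have sK: "strongly_connected ?K" by (rule induced_connected_imp_strongly_connected[OF iK])
      have HK: "subgraph H ?K" using y(2) yK subgraph_trans by blast
      have HK': "H = ?K"
        using m HK sK induced_imp_subgraph[OF iK] unfolding max_subgraph_def by metis
      have K: "verts H = verts y" "arcs H = arcs ?K" by (subst HK', simp)+
      have "arcs y \<subseteq> arcs H" using yK K(2) unfolding subgraph_def by simp
      moreover have "arcs H \<subseteq> arcs y" "tail H = tail y" "head H = head y"
        using y(2) unfolding subgraph_def compatible_def by simp_all
      ultimately have "H = y" using K(1) by (intro pre_digraph.equality) simp_all
      then show False using y(1) by simp
    qed
  qed
  then show "H \<in> components G" by (simp add: components_def)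
qed

lemma (in wf_digraph) reachable_closed:
  assumes "u \<rightarrow>\<^sup>* w" "u \<in> D" "\<And>a b. a \<in> D \<Longrightarrow> a \<rightarrow> b \<Longrightarrow> b \<in> D"
  shows "w \<in> D"
  using assms(1) by (induction rule: reachable_induct) (use assms in auto)

text \<open>Otherwise no arc leads from \<open>D\<close> to a remaining vertex \<open>w\<close> once
  \<open>c\<close> is deleted. So the deletion leaves at least two components where there was one,
  and \<open>c\<close> is a cut-vertex.\<close>

lemma (in graph) two_connected_separator:
  assumes tc: "two_connected G" and D: "D \<noteq> {}" "D \<subseteq> verts G"
    and N: "\<And>u w. u \<in> D \<Longrightarrow> u \<rightarrow> w \<Longrightarrow> w \<in> D \<or> w = c"
  shows "verts G \<subseteq> D \<union> {c}"
proof (rule ccontr)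
  assume "\<not> ?thesis"
  then obtain w where w: "w \<in> verts G" "w \<notin> D" "w \<noteq> c" by auto
  obtain u where u: "u \<in> D" using D by auto
  have sc: "strongly_connected G"
    using tc symmetric_connected_imp_strongly_connected[OF sym_arcs] unfolding two_connected_def by blast
  have uw: "u \<rightarrow>\<^sup>* w" using sc u D w by auto
  \<comment> \<open>Nothing is assumed about \<open>c\<close>. If it is not a vertex outside
    \<open>D\<close>, then \<open>D\<close> is closed under arcs, although \<open>w\<close> is
    reachable from it.\<close>
  have "c \<in> verts G \<and> c \<notin> D"
  proof (rule ccontr)
    assume c: "\<not> ?thesis"
    have "w \<in> D"
    proof (rule reachable_closed[OF uw u])
      fix a b assume "a \<in> D" "a \<rightarrow> b"
      then show "b \<in> D" using N[of a b] c adj_in_verts(2)[of a b] by auto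
    qed
    then show False using w by simp
  qed
  then have "c \<in> verts G" "c \<notin> D" by auto
  let ?G = "del_vert c"
  have ind: "induced_subgraph ?G G"
    by (rule induced_subgraphI[OF subgraph_del_vert]) (auto simp: del_vert_simps)
  interpret S: sym_digraph ?G by (rule induced_graph_imp_graph[OF ind])
  interpret F: fin_digraph ?G by (rule fin_digraph_del_vert)
  have c1: "card (components G) = 1" using sc components_eq_sccs strongly_connected_eq_iff by simp
  let ?R = "\<lambda>v. ?G \<restriction> {w. v \<rightarrow>\<^sup>*\<^bsub>?G\<^esub> w}"
  have mem: "?R u \<in> components ?G" "?R w \<in> components ?G"
    using S.induce_reachable_is_in_sccs S.components_eq_sccs u D w \<open>c \<notin> D\<close>
    by (auto simp: del_vert_simps)
  have "\<not> u \<rightarrow>\<^sup>*\<^bsub>?G\<^esub> w"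
  proof
    assume "u \<rightarrow>\<^sup>*\<^bsub>?G\<^esub> w"
    then have "w \<in> D"
    proof (rule S.reachable_closed)
      fix a b assume ab: "a \<in> D" "a \<rightarrow>\<^bsub>?G\<^esub> b"
      then have "a \<rightarrow> b" "b \<noteq> c" by (auto simp: arcs_ends_conv del_vert_simps)
      then show "b \<in> D" using N ab by blast
    qed (rule u)
    then show False using w by simp
  qed
  moreover have "w \<rightarrow>\<^sup>*\<^bsub>?G\<^esub> w" using w by (simp add: del_vert_simps)
  ultimately have "verts (?R u) \<noteq> verts (?R w)" by auto
  then have "?R u \<noteq> ?R w" by metis
  moreover have "card {A, B} = 2" if "A \<noteq> B" for A B :: "('a, 'b) pre_digraph" using that by simp
  ultimately have "card {?R u, ?R w} = 2" by blast
  moreover have "finite (components ?G)"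
    unfolding S.components_eq_sccs S.sccs_conv_sccs_verts using F.finite_sccs_verts by simp
  ultimately have "2 \<le> card (components ?G)" using mem by (metis card_mono empty_subsetI insert_subset)
  then have "cut_vertex G c" using c1 \<open>c \<in> verts G\<close> unfolding cut_vertex_def by simp
  then show False using tc unfolding two_connected_def by blast
qed

lemma (in graph) component_of_induced:
  assumes H: "H \<in> components (G \<restriction> W)" and W: "W \<subseteq> verts G"
  shows "verts H \<noteq> {}" "verts H \<subseteq> W"
    and "u \<in> verts H \<Longrightarrow> u \<rightarrow> w \<Longrightarrow> w \<in> W \<Longrightarrow> w \<in> verts H"
    and "D \<noteq> {} \<Longrightarrow> D \<subseteq> verts H \<Longrightarrow> nbh (verts H) (\<lambda>u w. u \<rightarrow> w) D = {} \<Longrightarrow> D = verts H"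
proof -
  interpret S: sym_digraph "G \<restriction> W" by (rule induced_graph_imp_graph[OF induced_induce[OF W]])
  have Hs: "H \<in> S.sccs" using H S.components_eq_sccs by simp
  then have V: "verts H \<in> S.sccs_verts" using S.sccs_verts_conv by auto
  then show ne: "verts H \<noteq> {}" unfolding S.in_sccs_verts_conv_reachable by blast
  show sub: "verts H \<subseteq> W" using S.sccs_verts_subsets[OF V] by simp
  have arc: "a \<rightarrow>\<^bsub>G \<restriction> W\<^esub> b \<longleftrightarrow> a \<rightarrow> b \<and> a \<in> W \<and> b \<in> W" for a b
    by (auto simp: arcs_ends_conv)
  show cl: "w \<in> verts H" if "u \<in> verts H" "u \<rightarrow> w" "w \<in> W" for u w
  proof -
    have "u \<rightarrow>\<^bsub>G \<restriction> W\<^esub> w" "w \<rightarrow>\<^bsub>G \<restriction> W\<^esub> u"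
      using arc that sub graph_symmetric by auto
    then show ?thesis using V that(1) unfolding S.in_sccs_verts_conv_reachable by blast
  qed
  show "D = verts H" if D: "D \<noteq> {}" "D \<subseteq> verts H" "nbh (verts H) (\<lambda>u w. u \<rightarrow> w) D = {}"
  proof
    show "verts H \<subseteq> D"
    proof
      fix w assume w: "w \<in> verts H"
      obtain u where u: "u \<in> D" using D by auto
      have "u \<rightarrow>\<^sup>*\<^bsub>G \<restriction> W\<^esub> w" using V u w D(2) unfolding S.in_sccs_verts_conv_reachable by blast
      then show "w \<in> D"
      proof (rule S.reachable_closed)
        fix a b assume "a \<in> D" "a \<rightarrow>\<^bsub>G \<restriction> W\<^esub> b"
        then have "a \<in> D" "a \<rightarrow> b" "b \<in> verts H" using arc cl D(2) by auto
        then show "b \<in> D" using D(3) unfolding nbh_def by auto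
      qed (rule u)
    qed
  qed (rule D(2))
qed

section \<open>Arc walks, degrees and fans\<close>

lemma (in wf_digraph) awalk_of_verts:
  assumes "p \<noteq> []" "set p \<subseteq> verts G" "successively (\<lambda>u w. u \<rightarrow> w) p"
  shows "\<exists>w. awalk (hd p) w (last p) \<and> awalk_verts (hd p) w = p"
  using assms
proof (induction p)
  case Nil then show ?case by simp
next
  case (Cons u p)
  show ?case
  proof (cases p)
    case Nil
    then show ?thesis using Cons.prems by (intro exI[of _ "[]"]) (auto simp: awalk_Nil_iff)
  next
    case (Cons v p')
    then obtain w where w: "awalk v w (last p)" "awalk_verts v w = p"
      using Cons.IH Cons.prems by auto
    have "u \<rightarrow> v" using Cons.prems Cons by auto
    then obtain a where a: "a \<in> arcs G" "tail G a = u" "head G a = v" by (auto simp: arcs_ends_conv)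
    then show ?thesis using w Cons by (intro exI[of _ "a # w"]) (auto simp: awalk_Cons_iff)
  qed
qed

text \<open>The start of a path does not recur, so its first edge differs from all later ones even
  when orientations are forgotten.\<close>

lemma (in wf_digraph) card_edges_apath:
  assumes "apath u p v"
  shows "card ((\<lambda>a. {tail G a, head G a}) ` set p) = length p"
  using assms
proof (induction p arbitrary: u)
  case Nil then show ?case by simp
next
  case (Cons a p)
  then have a: "apath (head G a) p v" "tail G a = u" "u \<notin> set (awalk_verts (head G a) p)"
    by (auto simp: apath_def awalk_Cons_iff)
  have "{tail G a, head G a} \<notin> (\<lambda>a. {tail G a, head G a}) ` set p"
  proof
    assume "{tail G a, head G a} \<in> (\<lambda>a. {tail G a, head G a}) ` set p"
    then obtain b where b: "b \<in> set p" "u \<in> {tail G b, head G b}" using a(2) by auto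
    have "awalk (head G a) p v" using a(1) unfolding apath_def by blast
    then have "tail G b \<in> set (awalk_verts (head G a) p)" "head G b \<in> set (awalk_verts (head G a) p)"
      using b(1) awalk_verts_arc1 awalk_verts_arc2 unfolding awalk_def by auto
    then show False using a(3) b(2) by auto
  qed
  then show ?case using Cons.IH[OF a(1)] by simp
qed

lemma (in graph) out_degree_eq_card: "out_degree G v = card {w. v \<rightarrow> w}"
proof -
  have "{w. v \<rightarrow> w} = head G ` out_arcs G v" by (auto simp: arcs_ends_conv out_arcs_def)
  moreover have "inj_on (head G) (out_arcs G v)"
    by (rule inj_onI) (auto simp: out_arcs_def arc_to_ends_def intro!: no_multi_arcs)
  ultimately show ?thesis unfolding out_degree_def by (simp add: card_image)
qed

lemma (in graph) cycle_verts_card: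
  assumes "graph_cycle G C"
  shows "cycle_verts G C \<subseteq> verts G" "3 \<le> card (cycle_verts G C)"
proof -
  obtain u where u: "awalk u C u" "distinct (tl (awalk_verts u C))" "C \<noteq> []" "3 \<le> length C"
    using assms unfolding graph_cycle_def cycle_def by auto
  then obtain a C' where C: "C = a # C'" by (cases C) auto
  have C': "C' \<noteq> []" using u(4) C by auto
  have w: "awalk (head G a) C' u" "tail G a = u" using u(1) C by (auto simp: awalk_Cons_iff)
  \<comment> \<open>Without its first entry, the vertex list of the closed walk consists of the
    tails of the other arcs followed by \<open>u\<close>, the tail of the first arc. Hence all tails
    are distinct.\<close>
  have "awalk_verts (head G a) C' = map (tail G) C' @ [head G (last C')]"
    using w(1) C' by (subst awalk_verts_conv) auto
  moreover have "head G (last C') = u"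
    using w(1) calculation by (metis awlast_of_awalk last_snoc awalkE)
  ultimately have "distinct (map (tail G) C' @ [u])" using u(2) C by simp
  then have "distinct (map (tail G) C)" using C w(2) by simp
  then show "3 \<le> card (cycle_verts G C)"
    unfolding cycle_verts_def using u(4) distinct_card by fastforce
  show "cycle_verts G C \<subseteq> verts G" using u(1) unfolding cycle_verts_def awalk_def by auto
qed

text \<open>The origin is \<open>hd q\<close>. One leg runs along \<open>q\<close> and on to
  \<open>s\<close>, which gives \<open>length q\<close> edges; each vertex of \<open>T\<close> is
  the terminus of a leg with a single edge.\<close>

lemma (in graph) fan_of_spider:
  assumes S: "cycle_verts G C \<subseteq> verts G" and H: "verts H \<subseteq> verts G - cycle_verts G C"
    and q: "q \<noteq> []" "set q \<subseteq> verts H" "distinct q" "successively (\<lambda>u w. u \<rightarrow> w) q" "last q \<rightarrow> s"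
    and s: "s \<in> cycle_verts G C" and T: "T \<subseteq> cycle_verts G C - {s}" "T \<noteq> {}" "\<forall>t\<in>T. hd q \<rightarrow> t"
  shows "\<exists>F. is_fan G H C F \<and> length q + card T \<le> card (edges F)"
proof -
  define v where "v = hd q"
  have "v \<in> set q" using q(1) unfolding v_def by simp
  then have v: "v \<in> verts H" "v \<in> verts G" "v \<in> set q" using q(2) H by auto
  have sq: "s \<notin> set q" using s q(2) H by auto
  have "\<exists>w. awalk (hd (q @ [s])) w (last (q @ [s])) \<and> awalk_verts (hd (q @ [s])) w = q @ [s]"
    by (rule awalk_of_verts) (use q s S H in \<open>auto simp: successively_append_iff\<close>)
  then obtain w where w: "awalk v w s" "awalk_verts v w = q @ [s]" using q(1) unfolding v_def by auto
  have w0: "w \<noteq> []" using w(2) q(1) by (cases w) auto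
  have lw: "length w = length q" using arg_cong[OF w(2), of length] w0 by (simp add: awalk_verts_conv)
  have "map (tail G) w = q" using w(2) w0 by (simp add: awalk_verts_conv)
  then have iw: "set (inner_verts w) \<subseteq> verts H"
    using q(1,2) unfolding inner_verts_def by (metis list.set_sel(2) subset_code(1))
  have aw: "apath v w s" using w q(3) sq unfolding apath_def by simp
  have "\<exists>a. a \<in> arcs G \<and> tail G a = v \<and> head G a = t" if "t \<in> T" for t
    using T(3) that unfolding v_def by (fastforce simp: arcs_ends_conv)
  then obtain a where a: "\<And>t. t \<in> T \<Longrightarrow> a t \<in> arcs G \<and> tail G (a t) = v \<and> head G (a t) = t" by metis
  have Tq: "t \<notin> set q" "t \<noteq> s" "t \<noteq> v" "t \<in> cycle_verts G C" "t \<in> verts G" if "t \<in> T" for t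
    using that T(1) q(2) H v S by auto
  have sT: "s \<notin> T" using T(1) by auto
  have av: "awalk_verts v [a t] = [v, t]" if "t \<in> T" for t using a[OF that] by simp
  have aa: "apath v [a t] t" if "t \<in> T" for t
    using a[OF that] Tq[OF that] v unfolding apath_def by (auto simp: awalk_Cons_iff awalk_Nil_iff)
  define P where "P = insert w ((\<lambda>t. [a t]) ` T)"
  have finT: "finite T" using T(1) S finite_verts by (metis finite_Diff finite_subset)
  have P_cases: "p = w \<or> (\<exists>t\<in>T. p = [a t])" if "p \<in> P" for p using that unfolding P_def by auto
  have walks: "awalk v p (awlast v p)" if "p \<in> P" for p
    using P_cases[OF that]
  proof (elim disjE bexE)
    assume "p = w" then show ?thesis using w by simp
  next
    fix t assume t: "t \<in> T" "p = [a t]"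
    then have "awlast v p = t" using av[OF t(1)] by simp
    then show ?thesis using aa[OF t(1)] t(2) unfolding apath_def by simp
  qed
  have ends: "tail G b \<in> set (awalk_verts v p) \<and> head G b \<in> set (awalk_verts v p)" if "p \<in> P" "b \<in> set p" for p b
    using walks[OF that(1)] that(2) awalk_verts_arc1 awalk_verts_arc2 unfolding awalk_def by auto
  define F where "F = \<lparr>verts = (\<Union>p\<in>P. set (awalk_verts v p)),
    arcs = {a \<in> arcs G. \<exists>p\<in>P. \<exists>b\<in>set p. {tail G a, head G a} = {tail G b, head G b}}, tail = tail G, head = head G\<rparr>"
  have Fs: "verts F = (\<Union>p\<in>P. set (awalk_verts v p))"
    "arcs F = {a \<in> arcs G. \<exists>p\<in>P. \<exists>b\<in>set p. {tail G a, head G a} = {tail G b, head G b}}"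
    "tail F = tail G" "head F = head G" unfolding F_def by simp_all
  have "subgraph F G"
  proof (rule subgraphI)
    show "verts F \<subseteq> verts G" using walks unfolding Fs by (auto elim!: awalkE)
    show "arcs F \<subseteq> arcs G" unfolding Fs by auto
    show "compatible G F" unfolding compatible_def Fs by simp
    show "wf_digraph F"
    proof
      fix e assume "e \<in> arcs F"
      then obtain p b where e: "p \<in> P" "b \<in> set p" "{tail G e, head G e} = {tail G b, head G b}" unfolding Fs by auto
      then have "{tail G e, head G e} \<subseteq> set (awalk_verts v p)" using ends by auto
      then show "tail F e \<in> verts F" "head F e \<in> verts F" using e(1) unfolding Fs by auto
    qed
  qed (rule wf_digraph_axioms)
  moreover have "2 \<le> card P"
  proof -
    obtain t where t: "t \<in> T" using T(2) by auto
    have "w \<noteq> [a t]" using w(2) av[OF t] Tq[OF t] by auto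
    then have "card {w, [a t]} = 2" by simp
    moreover have "{w, [a t]} \<subseteq> P" "finite P" using t finT unfolding P_def by auto
    ultimately show ?thesis by (metis card_mono)
  qed
  moreover have "\<forall>p\<in>P. \<exists>u\<in>cycle_verts G C. apath v p u"
    using aw aa s Tq(4) unfolding P_def by blast
  moreover have "inj_on (awlast v) P"
  proof (rule inj_onI)
    fix p p' assume p: "p \<in> P" "p' \<in> P" "awlast v p = awlast v p'"
    show "p = p'"
      using P_cases[OF p(1)] P_cases[OF p(2)] p(3) w(2) av sT by auto
  qed
  moreover have "\<forall>p\<in>P. set (inner_verts p) \<subseteq> verts H" using iw unfolding P_def by auto
  moreover have "\<forall>p\<in>P. \<forall>p'\<in>P. p \<noteq> p' \<longrightarrow> set (awalk_verts v p) \<inter> set (awalk_verts v p') = {v}"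
  proof (intro ballI impI)
    fix p p' assume p: "p \<in> P" "p' \<in> P" "p \<noteq> p'"
    show "set (awalk_verts v p) \<inter> set (awalk_verts v p') = {v}"
      using P_cases[OF p(1)] P_cases[OF p(2)] p(3) w(2) av Tq(1,3) sT v(3) by auto
  qed
  ultimately have "is_fan G H C F"
    unfolding is_fan_def using v(1) Fs(1,2) by blast
  moreover have "length q + card T \<le> card (edges F)"
  proof -
    let ?e = "\<lambda>a. {tail G a, head G a}"
    have "?e ` set w \<union> (\<lambda>t. {v, t}) ` T \<subseteq> edges F"
    proof -
      have "set w \<subseteq> arcs F" using w(1) unfolding Fs P_def by auto
      moreover have "a t \<in> arcs F" if "t \<in> T" for t using a[OF that] that unfolding Fs P_def by auto
      moreover have "{v, t} = ?e (a t)" if "t \<in> T" for t using a[OF that] by simp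
      ultimately show ?thesis unfolding edges_def Fs(3,4) by (intro Un_least image_subsetI) auto
    qed
    moreover have "finite (edges F)" unfolding edges_def Fs by simp
    ultimately have "card (?e ` set w \<union> (\<lambda>t. {v, t}) ` T) \<le> card (edges F)" by (rule card_mono[rotated])
    moreover have "card (?e ` set w \<union> (\<lambda>t. {v, t}) ` T) = card (?e ` set w) + card ((\<lambda>t. {v, t}) ` T)"
    proof (rule card_Un_disjoint)
      show "?e ` set w \<inter> (\<lambda>t. {v, t}) ` T = {}"
      proof (rule equals0I)
        fix X assume X: "X \<in> ?e ` set w \<inter> (\<lambda>t. {v, t}) ` T"
        then obtain b where "b \<in> set w" "X = ?e b" by auto
        then have "X \<subseteq> set (q @ [s])" using ends[of w b] w(2) unfolding P_def by auto
        moreover obtain t where "t \<in> T" "X = {v, t}" using X by auto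
        ultimately show False using Tq(1,2)[of t] by simp
      qed
    qed (use finT in auto)
    moreover have "card ((\<lambda>t. {v, t}) ` T) = card T"
      by (rule card_image) (auto simp: inj_on_def doubleton_eq_iff)
    ultimately show ?thesis using card_edges_apath[OF aw] lw by simp
  qed
  ultimately show ?thesis by blast
qed

theorem theorem2p1:
  fixes G H :: "('a, 'b) pre_digraph" and C :: "'b awalk" and k :: nat
  assumes "0 < k"
    and "graph G"
    and "two_connected G"
    and "graph_cycle G C"
    and "H \<in> components (G \<restriction> (verts G - cycle_verts G C))"
    and "(real (card (verts H)) + 1) / 2 \<le> real (card {v \<in> verts H. k \<le> degree G v})"
  shows "\<exists>F. is_fan G H C F \<and> k \<le> card (edges F)"
proof -
  interpret graph G by fact
  let ?S = "cycle_verts G C"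
  let ?E = "\<lambda>u w. u \<rightarrow>\<^bsub>G\<^esub> w"
  note S = cycle_verts_card[OF assms(4)]
  note HC = component_of_induced[OF assms(5) Diff_subset]
  have HS: "verts H \<subseteq> verts G - ?S" by (rule HC(2))
  have fin: "finite (verts H)" "finite ?S" using HS S(1) finite_verts finite_subset by blast+
  have out: "w \<in> verts H \<union> ?S" if "u \<in> verts H" "u \<rightarrow>\<^bsub>G\<^esub> w" for u w
    using HC(3)[OF that] adj_in_verts(2)[OF that(2)] by auto
  have two: "\<not> nbh (verts H \<union> ?S) ?E D \<subseteq> {c}" if D: "D \<noteq> {}" "D \<subseteq> verts H" for D c
  proof
    assume N: "nbh (verts H \<union> ?S) ?E D \<subseteq> {c}"
    have "verts G \<subseteq> D \<union> {c}"
    proof (rule two_connected_separator[OF assms(3) D(1)])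
      show "D \<subseteq> verts G" using D HS by auto
      fix u w assume u: "u \<in> D" "u \<rightarrow>\<^bsub>G\<^esub> w"
      then show "w \<in> D \<or> w = c" using N out[of u w] D(2) unfolding nbh_def by auto
    qed
    then have "?S \<subseteq> {c}" using S(1) D HS by auto
    then have "card ?S \<le> card {c}" by (intro card_mono) auto
    then show False using S(2) by simp
  qed
  have deg: "deg (verts H \<union> ?S) ?E v = degree G v" if "v \<in> verts H" for v
  proof -
    have "{w \<in> verts H \<union> ?S. v \<rightarrow>\<^bsub>G\<^esub> w} = {w. v \<rightarrow>\<^bsub>G\<^esub> w}" using out that by auto
    then show ?thesis unfolding deg_def out_degree_eq_card by simp
  qed
  have "{v \<in> verts H. k \<le> degree G v} = {v \<in> verts H. k \<le> deg (verts H \<union> ?S) ?E v}" using deg by auto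
  then have many: "card (verts H) + 1 \<le> 2 * card {v \<in> verts H. k \<le> deg (verts H \<union> ?S) ?E v}"
    using assms(6) by simp
  have "symp ?E" using graph_symmetric by (auto intro: sympI)
  moreover have "irreflp ?E" using no_loops by (auto intro!: irreflpI simp: arcs_ends_conv)
  ultimately obtain q s T where "q \<noteq> []" "set q \<subseteq> verts H" "distinct q" "successively ?E q" "last q \<rightarrow>\<^bsub>G\<^esub> s"
    "s \<in> ?S" "T \<subseteq> ?S - {s}" "T \<noteq> {}" "\<forall>t\<in>T. hd q \<rightarrow>\<^bsub>G\<^esub> t" and k: "k \<le> length q + card T"
    using long_spider[OF fin _ HC(1) _ _ HC(4) two many] HS by blast
  from fan_of_spider[OF S(1) HS this(1-9)] k show ?thesis by (meson le_trans)
qed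

end
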